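(* A class of point equivalent second order ODEs $x''=F(t,x,x')$ defines a projective structure on its solution space if and only if $$4V'(K_0)-V(K_0')=0.$$ Additionally, the Cartan invariant $C$ satisfies $C=4V'(K_0)-V(K_0')$.
   Context: On $J^1(\mathbb{R},\mathbb{R})$ with coordinates $t,x_0,x_1$, $\partial_i=\partial/\partial x_i$, let $X_F=\partial_t+x_1\partial_0+F\partial_1$. The solution space is the (local) quotient $M_F=J^1(\mathbb{R},\mathbb{R})/X_F$, with projection $\pi$. Point transformations are transformations of the variables $(t,x)$. The class of the equation defines a projective structure on the solution space if there is a projective structure on the surface $M_F$ (class of torsion-free connections with the same unparametrised geodesics) for which the projections to $M_F$ of the integral curves of $\mathcal{D}_1=\mathrm{span}\{\partial_1\}$ are geodesics; equivalently there is a connection on $M_F$ for which all these projected curves are totally geodesic. A prime on a function denotes its derivative along $X_F$. Let $g$ be a nowhere vanishing local solution of $X_F(g)=\frac{g}{2}\partial_1F$, $V=g\partial_1$, $V'=[X_F,V]$; the function $K_0$ is defined by $[X_F,[X_F,V]]=-K_0V$. Explicitly $K_0=-\partial_0F+\frac12X_F(\partial_1F)-\frac14(\partial_1F)^2$ and, neglecting the common factor $g$ (as is done in the identity for $C$), $V=\partial_1$, $V'=-\partial_0-\frac12\partial_1F\,\partial_1$. The Cartan invariant is \begin{align*} C={}&\partial_0^2F-\tfrac12F\partial_0\partial_1^2F-\tfrac12\partial_0F\partial_1^2F-\tfrac23\partial_t\partial_0\partial_1F+\tfrac16\partial_t^2\partial_1^2F+\tfrac13x_1\partial_t\partial_0\partial_1^2F+\tfrac16\partial_tF\partial_1^3F\\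 &+\tfrac13F\partial_t\partial_1^3F-\tfrac23x_1\partial_0^2\partial_1F+\tfrac16x_1^2\partial_0^2\partial_1^2F+\tfrac16x_1\partial_0F\partial_1^3F+\tfrac13x_1F\partial_0\partial_1^3F+\tfrac23\partial_1F\partial_0\partial_1F\\ &-\tfrac16\partial_1F\partial_t\partial_1^2F-\tfrac16x_1\partial_1F\partial_0\partial_1^2F+\tfrac16F^2\partial_1^4F. \end{align*}
   Formalization: The printed formula fails (F = x_1^3: C = 0 and the solution space is flat, but 4V'(K_0) - V(K_0') = -36 x_1^5). Proved instead: the criterion is 4V'(K_0) + V(K_0') = 0, and 3C = 4V'(K_0) + V(K_0'). *)

theory Defs
  imports "HOL-Analysis.Analysis"
begin

section \<open>Smooth maps and vector fields\<close>

text \<open>All domains are open sets, so derivatives are taken at interior points.\<close>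

fun times_differentiable_on ::
  "nat \<Rightarrow> 'a::real_normed_vector set \<Rightarrow> ('a \<Rightarrow> 'b::real_normed_vector) \<Rightarrow> bool" where
  "times_differentiable_on 0 S f \<longleftrightarrow> continuous_on S f"
| "times_differentiable_on (Suc n) S f \<longleftrightarrow>
     (\<forall>x\<in>S. f differentiable (at x)) \<and>
     (\<forall>v. times_differentiable_on n S (\<lambda>x. frechet_derivative f (at x) v))"

definition smooth_on :: "'a::real_normed_vector set \<Rightarrow> ('a \<Rightarrow> 'b::real_normed_vector) \<Rightarrow> bool" where
  "smooth_on S f \<longleftrightarrow> (\<forall>n. times_differentiable_on n S f)"

text \<open>The function \<open>X(f)\<close>, the derivative of \<open>f\<close> along the vector field \<open>X\<close>.\<close>

definition vf_apply ::
  "('a::real_normed_vector \<Rightarrow> 'a) \<Rightarrow> ('a \<Rightarrow> 'b::real_normed_vector) \<Rightarrow> 'a \<Rightarrow> 'b" where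
  "vf_apply X f = (\<lambda>p. frechet_derivative f (at p) (X p))"

text \<open>Sign convention: \<open>[X,Y](f) = X(Y(f)) - Y(X(f))\<close>.\<close>

definition lie_bracket ::
  "('a::real_normed_vector \<Rightarrow> 'a) \<Rightarrow> ('a \<Rightarrow> 'a) \<Rightarrow> 'a \<Rightarrow> 'a" where
  "lie_bracket X Y = (\<lambda>p. vf_apply X Y p - vf_apply Y X p)"


section \<open>The jet space and the ODE\<close>

text \<open>A point of the jet space is \<open>(t, x\<^sub>0, x\<^sub>1)\<close>.\<close>

type_synonym jet = "real \<times> real \<times> real"

definition e_t :: jet where "e_t = (1, 0, 0)"
definition e_0 :: jet where "e_0 = (0, 1, 0)"
definition e_1 :: jet where "e_1 = (0, 0, 1)"

definition pd_t :: "(jet \<Rightarrow> real) \<Rightarrow> jet \<Rightarrow> real" where "pd_t = vf_apply (\<lambda>p. e_t)"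
definition pd_0 :: "(jet \<Rightarrow> real) \<Rightarrow> jet \<Rightarrow> real" where "pd_0 = vf_apply (\<lambda>p. e_0)"
definition pd_1 :: "(jet \<Rightarrow> real) \<Rightarrow> jet \<Rightarrow> real" where "pd_1 = vf_apply (\<lambda>p. e_1)"

definition jet_x1 :: "jet \<Rightarrow> real" where "jet_x1 p = snd (snd p)"

definition X_field :: "(jet \<Rightarrow> real) \<Rightarrow> jet \<Rightarrow> jet" where
  "X_field F = (\<lambda>p. e_t + jet_x1 p *\<^sub>R e_0 + F p *\<^sub>R e_1)"


section \<open>The solution space\<close>

definition same_integral_curve :: "jet set \<Rightarrow> (jet \<Rightarrow> jet) \<Rightarrow> jet \<Rightarrow> jet \<Rightarrow> bool" where
  "same_integral_curve U X p q \<longleftrightarrow>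
     (\<exists>c a b. a \<le> b \<and> {c a, c b} = {p, q} \<and>
        (\<forall>s\<in>{a..b}. c s \<in> U \<and> (c has_vector_derivative X (c s)) (at s within {a..b})))"

text \<open>
  \<open>\<pi>\<close> presents the open set \<open>\<pi> ` U\<close> of the plane as the quotient of \<open>U\<close> by the integral curves of
  \<open>X_field F\<close>: a smooth submersion whose fibres are exactly these curves. Being a
  local quotient, the solution space is covered by one coordinate chart.
\<close>

definition solution_space ::
  "(jet \<Rightarrow> real) \<Rightarrow> jet set \<Rightarrow> (jet \<Rightarrow> real \<times> real) \<Rightarrow> bool" where
  "solution_space F U \<pi> \<longleftrightarrow>
     smooth_on U \<pi> \<and>
     (\<forall>p\<in>U. surj (frechet_derivative \<pi> (at p))) \<and>
     (\<forall>p\<in>U. \<forall>q\<in>U. \<pi> p = \<pi> q \<longleftrightarrow> same_integral_curve U (X_field F) p q)"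


section \<open>Projective structures on a surface\<close>

text \<open>
  A connection on an open set \<open>M\<close> of a vector space is \<open>\<nabla>\<^sub>v w = D w(v) + \<Gamma> m v w\<close>; it is
  torsion-free when \<open>\<Gamma> m\<close> is symmetric. Values of \<open>\<Gamma>\<close> outside \<open>M\<close> are irrelevant.
\<close>

type_synonym 'a connection = "'a \<Rightarrow> 'a \<Rightarrow> 'a \<Rightarrow> 'a"

definition torsion_free_connection :: "'a::real_normed_vector set \<Rightarrow> 'a connection \<Rightarrow> bool" where
  "torsion_free_connection M \<Gamma> \<longleftrightarrow>
     (\<forall>m\<in>M. bilinear (\<Gamma> m) \<and> (\<forall>v w. \<Gamma> m v w = \<Gamma> m w v)) \<and>
     (\<forall>v w. smooth_on M (\<lambda>m. \<Gamma> m v w))"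

definition regular_curve ::
  "'a::real_normed_vector set \<Rightarrow> real set \<Rightarrow> (real \<Rightarrow> 'a) \<Rightarrow> bool" where
  "regular_curve M I c \<longleftrightarrow>
     open I \<and> connected I \<and> smooth_on I c \<and> c ` I \<subseteq> M \<and>
     (\<forall>s\<in>I. vector_derivative c (at s) \<noteq> 0)"

text \<open>Unparametrised geodesics: the acceleration is proportional to the velocity.\<close>

definition unparam_geodesic ::
  "'a::real_normed_vector set \<Rightarrow> 'a connection \<Rightarrow> real set \<Rightarrow> (real \<Rightarrow> 'a) \<Rightarrow> bool" where
  "unparam_geodesic M \<Gamma> I c \<longleftrightarrow>
     regular_curve M I c \<and>
     (\<forall>s\<in>I. \<exists>k. vector_derivative (\<lambda>r. vector_derivative c (at r)) (at s)
              + \<Gamma> (c s) (vector_derivative c (at s)) (vector_derivative c (at s))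
              = k *\<^sub>R vector_derivative c (at s))"

definition projectively_equivalent ::
  "'a::real_normed_vector set \<Rightarrow> 'a connection \<Rightarrow> 'a connection \<Rightarrow> bool" where
  "projectively_equivalent M \<Gamma> \<Delta> \<longleftrightarrow>
     (\<forall>I c. unparam_geodesic M \<Gamma> I c \<longleftrightarrow> unparam_geodesic M \<Delta> I c)"

definition projective_structure ::
  "'a::real_normed_vector set \<Rightarrow> 'a connection set \<Rightarrow> bool" where
  "projective_structure M P \<longleftrightarrow>
     (\<exists>\<Gamma>. torsion_free_connection M \<Gamma> \<and>
          P = {\<Delta>. torsion_free_connection M \<Delta> \<and> projectively_equivalent M \<Gamma> \<Delta>})"

definition integral_curve_D1 :: "jet set \<Rightarrow> real set \<Rightarrow> (real \<Rightarrow> jet) \<Rightarrow> bool" where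
  "integral_curve_D1 U I c \<longleftrightarrow>
     regular_curve U I c \<and> (\<forall>s\<in>I. vector_derivative c (at s) \<in> span {e_1})"

definition defines_projective_structure ::
  "jet set \<Rightarrow> (jet \<Rightarrow> real \<times> real) \<Rightarrow> bool" where
  "defines_projective_structure U \<pi> \<longleftrightarrow>
     (\<exists>P. projective_structure (\<pi> ` U) P \<and>
        (\<forall>I c. integral_curve_D1 U I c \<longrightarrow> (\<forall>\<Gamma>\<in>P. unparam_geodesic (\<pi> ` U) \<Gamma> I (\<pi> \<circ> c))))"


section \<open>Invariants\<close>

definition scaling :: "(jet \<Rightarrow> real) \<Rightarrow> jet set \<Rightarrow> (jet \<Rightarrow> real) \<Rightarrow> bool" where
  "scaling F U g \<longleftrightarrow>
     smooth_on U g \<and>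
     (\<forall>p\<in>U. g p \<noteq> 0 \<and> vf_apply (X_field F) g p = g p / 2 * pd_1 F p)"

definition V_field :: "(jet \<Rightarrow> real) \<Rightarrow> jet \<Rightarrow> jet" where
  "V_field g = (\<lambda>p. g p *\<^sub>R e_1)"

definition V'_field :: "(jet \<Rightarrow> real) \<Rightarrow> (jet \<Rightarrow> real) \<Rightarrow> jet \<Rightarrow> jet" where
  "V'_field F g = lie_bracket (X_field F) (V_field g)"

definition is_K0 ::
  "(jet \<Rightarrow> real) \<Rightarrow> jet set \<Rightarrow> (jet \<Rightarrow> real) \<Rightarrow> (jet \<Rightarrow> real) \<Rightarrow> bool" where
  "is_K0 F U g K \<longleftrightarrow>
     (\<forall>p\<in>U. lie_bracket (X_field F) (V'_field F g) p = - K p *\<^sub>R V_field g p)"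

text \<open>The same objects in explicit form, with the common factor \<open>g\<close> of \<open>V\<close> and \<open>V'\<close> dropped.\<close>

definition K0 :: "(jet \<Rightarrow> real) \<Rightarrow> jet \<Rightarrow> real" where
  "K0 F = (\<lambda>p. - pd_0 F p + 1/2 * vf_apply (X_field F) (pd_1 F) p - 1/4 * (pd_1 F p)\<^sup>2)"

definition V_explicit :: "jet \<Rightarrow> jet" where
  "V_explicit = (\<lambda>p. e_1)"

definition V'_explicit :: "(jet \<Rightarrow> real) \<Rightarrow> jet \<Rightarrow> jet" where
  "V'_explicit F = (\<lambda>p. - e_0 - (1/2 * pd_1 F p) *\<^sub>R e_1)"

text \<open>
  The combination is \<open>4 V'(K) + V(K')\<close> with \<open>K' = X_field F (K)\<close>; it equals three times the Cartan
  invariant. It is sometimes printed as \<open>4 V'(K) - V(K')\<close>, which is incompatible with the convention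
  \<open>V' = [X, V]\<close> used here: for \<open>F = x\<^sub>1\<^sup>3\<close>, whose solution space is flat and whose Cartan invariant
  vanishes, \<open>4 V'(K\<^sub>0) = -18 x\<^sub>1\<^sup>5\<close> and \<open>V(K\<^sub>0') = 18 x\<^sub>1\<^sup>5\<close>.
\<close>

definition obstruction ::
  "(jet \<Rightarrow> real) \<Rightarrow> (jet \<Rightarrow> jet) \<Rightarrow> (jet \<Rightarrow> jet) \<Rightarrow> (jet \<Rightarrow> real) \<Rightarrow> jet \<Rightarrow> real" where
  "obstruction F V V' K = (\<lambda>p. 4 * vf_apply V' K p + vf_apply V (vf_apply (X_field F) K) p)"

definition cartan_invariant :: "(jet \<Rightarrow> real) \<Rightarrow> jet \<Rightarrow> real" where
  "cartan_invariant F = (\<lambda>p. let x1 = jet_x1 p in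
       pd_0 (pd_0 F) p
     - 1/2 * F p * pd_0 (pd_1 (pd_1 F)) p
     - 1/2 * pd_0 F p * pd_1 (pd_1 F) p
     - 2/3 * pd_t (pd_0 (pd_1 F)) p
     + 1/6 * pd_t (pd_t (pd_1 (pd_1 F))) p
     + 1/3 * x1 * pd_t (pd_0 (pd_1 (pd_1 F))) p
     + 1/6 * pd_t F p * pd_1 (pd_1 (pd_1 F)) p
     + 1/3 * F p * pd_t (pd_1 (pd_1 (pd_1 F))) p
     - 2/3 * x1 * pd_0 (pd_0 (pd_1 F)) p
     + 1/6 * x1\<^sup>2 * pd_0 (pd_0 (pd_1 (pd_1 F))) p
     + 1/6 * x1 * pd_0 F p * pd_1 (pd_1 (pd_1 F)) p
     + 1/3 * x1 * F p * pd_0 (pd_1 (pd_1 (pd_1 F))) p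
     + 2/3 * pd_1 F p * pd_0 (pd_1 F) p
     - 1/6 * pd_1 F p * pd_t (pd_1 (pd_1 F)) p
     - 1/6 * x1 * pd_1 F p * pd_0 (pd_1 (pd_1 F)) p
     + 1/6 * (F p)\<^sup>2 * pd_1 (pd_1 (pd_1 (pd_1 F))) p)"

end

(*
Write X for X_field F, pi for the projection and pi_i, pi_ij for its derivatives along e_0, e_1. Since
X(pi) = 0, the vectors pi_0, pi_1 form a frame in which X acts by X(pi_0) = - F_0 pi_1 and
X(pi_1) = - pi_0 - F_1 pi_1. A curve with velocity along e_1 projects to a geodesic of a connection
Gamma exactly when p_11 = pi_11 + Gamma(pi_1, pi_1) is proportional to pi_1. Let (P, Q), (R, S), (T, Z)
be the frame components of p_11, p_01, p_00 with p_ij = pi_ij + Gamma(pi_i, pi_j). The projectively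
invariant combinations a_1 = P, a_2 = Q - 2R, a_3 = T - 2S, a_4 = Z satisfy a linear inhomogeneous system
along X which does not involve Gamma. If a_1 vanishes, the first three equations determine a_2, a_3, a_4
and the last one says that the Cartan invariant vanishes. Conversely, if the Cartan invariant vanishes,
then these values of the a_i solve the system, and their differences from the values for Gamma = 0 solve
the homogeneous system. This says that the trace-free symmetric tensor built from the differences is
constant along X, so it descends to the solution space.
*)

theory Submission
  imports Defs
begin

section \<open>Calculus of smooth maps\<close>

text \<open>Let A be the symmetric bilinear form with components p_ij. Up to sign, a_1, ..., a_4 are
  the coefficients of the cubic form det(v, A(v,v)) / det(pi_0, pi_1) in the frame. This cubic
  ignores multiples of v added to A(v,v), which is the freedom inside a projective class. A
  symmetric tensor without trace is determined by its cubic, hence the trace-free choice in the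
  converse. The vectors pi_ij enter because the frame varies along the fibres. A connection on the
  surface is constant along X and adds nothing inhomogeneous, so all inhomogeneous terms come from
  pi_ij, and thus from F.

  Two obstacles shape the formal proof. The presentation of the solution space speaks about fibres
  only, so even X(pi) = 0 has to be extracted from it by topology. And smoothness on the surface is
  accessible only through functions on the jet space, so smooth functions must be shown to descend,
  by inverting pi on slices of constant t.\<close>

abbreviation dir_deriv :: "'a::real_normed_vector \<Rightarrow> ('a \<Rightarrow> 'b::real_normed_vector) \<Rightarrow> 'a \<Rightarrow> 'b"
  where "dir_deriv v \<equiv> vf_apply (\<lambda>_. v)"

lemma has_derivative_vf_apply:
  "f differentiable (at p) \<Longrightarrow> (f has_derivative (\<lambda>v. dir_deriv v f p)) (at p)"
  unfolding vf_apply_def by (simp add: frechet_derivative_works)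

lemma vf_apply_eqI:
  "(f has_derivative f') (at p) \<Longrightarrow> vf_apply X f p = f' (X p)"
  unfolding vf_apply_def by (metis frechet_derivative_at)

lemma vf_apply_eq_dir_deriv: "vf_apply X f p = dir_deriv (X p) f p"
  by (simp add: vf_apply_def)

text \<open>\<open>frechet_derivative\<close> chooses from the set of derivatives at
  \<open>p\<close>. Functions that agree near \<open>p\<close> share this set, so the choices
  coincide whether or not a derivative exists.\<close>

lemma vf_apply_cong:
  assumes "open S" "p \<in> S" "\<And>x. x \<in> S \<Longrightarrow> f x = g x"
  shows "vf_apply X f p = vf_apply X g p"
proof -
  have "(f has_derivative f') (at p) = (g has_derivative f') (at p)" for f'
    using has_derivative_transform_within_open[of f f' p UNIV S g]
      has_derivative_transform_within_open[of g f' p UNIV S f] assms by auto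
  then show ?thesis
    unfolding vf_apply_def frechet_derivative_def by presburger
qed

lemma differentiable_cong:
  assumes "open S" "p \<in> S" "\<And>x. x \<in> S \<Longrightarrow> f x = g x" "f differentiable (at p)"
  shows "g differentiable (at p)"
  using assms by (meson differentiable_def has_derivative_transform_within_open)

lemma linear_vf_apply: "f differentiable (at p) \<Longrightarrow> linear (\<lambda>v. dir_deriv v f p)"
  using linear_frechet_derivative by (auto simp: vf_apply_def)

lemma vf_apply_const [simp]: "vf_apply X (\<lambda>_. c) p = 0"
  by (simp add: vf_apply_def)

lemma vf_apply_bounded_linear:
  assumes "bounded_linear L" "f differentiable (at p)"
  shows "vf_apply X (\<lambda>x. L (f x)) p = L (vf_apply X f p)"
  using bounded_linear.has_derivative[OF assms(1) has_derivative_vf_apply[OF assms(2)]]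
  by (simp add: vf_apply_eqI vf_apply_eq_dir_deriv[of X f])

lemma vf_apply_add:
  assumes "f differentiable (at p)" "g differentiable (at p)"
  shows "vf_apply X (\<lambda>x. f x + g x) p = vf_apply X f p + vf_apply X g p"
  using has_derivative_add[OF assms[THEN has_derivative_vf_apply]]
  by (simp add: vf_apply_eqI vf_apply_eq_dir_deriv[of X f] vf_apply_eq_dir_deriv[of X g])

lemma vf_apply_diff:
  assumes "f differentiable (at p)" "g differentiable (at p)"
  shows "vf_apply X (\<lambda>x. f x - g x) p = vf_apply X f p - vf_apply X g p"
  using has_derivative_diff[OF assms[THEN has_derivative_vf_apply]]
  by (simp add: vf_apply_eqI vf_apply_eq_dir_deriv[of X f] vf_apply_eq_dir_deriv[of X g])

lemma vf_apply_minus: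
  assumes "f differentiable (at p)"
  shows "vf_apply X (\<lambda>x. - f x) p = - vf_apply X f p"
  using vf_apply_bounded_linear[OF bounded_linear_minus[OF bounded_linear_ident] assms] by simp

lemma (in bounded_bilinear) vf_apply_prod:
  assumes "f differentiable (at p)" "g differentiable (at p)"
  shows "vf_apply X (\<lambda>x. prod (f x) (g x)) p
       = prod (f p) (vf_apply X g p) + prod (vf_apply X f p) (g p)"
  using FDERIV[OF assms[THEN has_derivative_vf_apply]]
  by (simp add: vf_apply_eqI vf_apply_eq_dir_deriv[of X f] vf_apply_eq_dir_deriv[of X g])

lemmas vf_apply_scaleR = bounded_bilinear.vf_apply_prod[OF bounded_bilinear_scaleR]
lemmas vf_apply_mult = bounded_bilinear.vf_apply_prod[OF bounded_bilinear_mult]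

lemma (in bounded_bilinear) differentiable_prod:
  assumes "f differentiable (at p)" "g differentiable (at p)"
  shows "(\<lambda>x. prod (f x) (g x)) differentiable (at p)"
  using FDERIV[OF assms[THEN has_derivative_vf_apply]] differentiable_def by blast

lemmas differentiable_scaleR_fun = bounded_bilinear.differentiable_prod[OF bounded_bilinear_scaleR]

lemma vf_apply_compose:
  assumes "f differentiable (at (g p))" "g differentiable (at p)"
  shows "vf_apply X (\<lambda>x. f (g x)) p = dir_deriv (vf_apply X g p) f (g p)"
  using has_derivative_compose[OF assms(2,1)[THEN has_derivative_vf_apply]]
  by (simp add: vf_apply_eqI vf_apply_eq_dir_deriv[of X g])

section \<open>Closure properties of smooth maps\<close>

lemma times_differentiable_on_Suc_iff:
  "times_differentiable_on (Suc n) S f \<longleftrightarrow>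
     (\<forall>x\<in>S. f differentiable (at x)) \<and> (\<forall>v. times_differentiable_on n S (dir_deriv v f))"
  by (simp add: vf_apply_def)

lemmas times_differentiable_on_SucI = times_differentiable_on_Suc_iff[THEN iffD2, OF conjI]

declare times_differentiable_on.simps(2) [simp del]

text \<open>Derivative rules identify \<open>dir_deriv v\<close> of a sum, product or composite only
  at points of \<open>S\<close>, while the next level of the recursion takes the whole function as
  argument; this lemma bridges the gap.\<close>

lemma times_differentiable_on_cong:
  assumes "open S" "\<And>x. x \<in> S \<Longrightarrow> f x = g x" "times_differentiable_on n S f"
  shows "times_differentiable_on n S g"
  using assms(2,3)
proof (induction n arbitrary: f g)
  case 0
  then show ?case by (simp cong: continuous_on_cong)
next
  case (Suc n)
  have f: "\<forall>x\<in>S. f differentiable (at x)" "\<forall>v. times_differentiable_on n S (dir_deriv v f)"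
    using Suc.prems(2) unfolding times_differentiable_on_Suc_iff by simp_all
  show ?case
  proof (intro times_differentiable_on_SucI ballI allI)
    fix x assume "x \<in> S"
    then show "g differentiable (at x)"
      by (intro differentiable_cong[OF assms(1) _ Suc.prems(1)]) (simp_all add: f(1))
  next
    fix v
    show "times_differentiable_on n S (dir_deriv v g)"
    proof (rule Suc.IH)
      show "times_differentiable_on n S (dir_deriv v f)" using f(2) by simp
      show "dir_deriv v f x = dir_deriv v g x" if "x \<in> S" for x
        by (rule vf_apply_cong[OF assms(1) that Suc.prems(1)])
    qed
  qed
qed

lemma smooth_on_cong:
  assumes "open S" "\<And>x. x \<in> S \<Longrightarrow> f x = g x" "smooth_on S f"
  shows "smooth_on S g"
  unfolding smooth_on_def
proof
  fix n show "times_differentiable_on n S g"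
    using assms(3) by (intro times_differentiable_on_cong[OF assms(1,2)]) (simp_all add: smooth_on_def)
qed

lemma smooth_on_differentiable:
  assumes "smooth_on S f" "x \<in> S"
  shows "f differentiable (at x)"
proof -
  have "times_differentiable_on (Suc 0) S f"
    using assms(1) unfolding smooth_on_def by blast
  then show ?thesis
    using assms(2) by (auto simp: times_differentiable_on_Suc_iff)
qed

lemma smooth_on_dir_deriv:
  assumes "smooth_on S f"
  shows "smooth_on S (dir_deriv v f)"
  unfolding smooth_on_def
proof
  fix n
  have "times_differentiable_on (Suc n) S f"
    using assms unfolding smooth_on_def by blast
  then show "times_differentiable_on n S (dir_deriv v f)"
    by (auto simp: times_differentiable_on_Suc_iff)
qed

lemma smooth_on_continuous:
  assumes "smooth_on S f"
  shows "continuous_on S f"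
proof -
  have "times_differentiable_on 0 S f"
    using assms unfolding smooth_on_def by blast
  then show ?thesis by simp
qed

lemma smooth_on_const: "smooth_on S (\<lambda>_. c)"
proof -
  have "times_differentiable_on n S (\<lambda>_. c)" for n and c :: 'b
  proof (induction n arbitrary: c)
    case (Suc n)
    have "dir_deriv v (\<lambda>_. c) = (\<lambda>_. 0)" for v :: 'a by (rule ext) simp
    with Suc show ?case by (simp add: times_differentiable_on_Suc_iff)
  qed simp
  then show ?thesis unfolding smooth_on_def by blast
qed

lemma times_differentiable_on_add:
  assumes "open S" "times_differentiable_on n S f" "times_differentiable_on n S g"
  shows "times_differentiable_on n S (\<lambda>x. f x + g x)"
  using assms(2,3)
proof (induction n arbitrary: f g)
  case 0
  then show ?case by (simp add: continuous_on_add)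
next
  case (Suc n)
  show ?case
  proof (intro times_differentiable_on_SucI ballI allI)
    fix x assume "x \<in> S"
    with Suc.prems show "(\<lambda>x. f x + g x) differentiable (at x)"
      by (simp add: times_differentiable_on_Suc_iff)
  next
    fix v
    show "times_differentiable_on n S (dir_deriv v (\<lambda>x. f x + g x))"
    proof (rule times_differentiable_on_cong[OF assms(1)])
      show "times_differentiable_on n S (\<lambda>x. dir_deriv v f x + dir_deriv v g x)"
        using Suc by (simp add: times_differentiable_on_Suc_iff)
    qed (use Suc.prems in \<open>simp add: vf_apply_add times_differentiable_on_Suc_iff\<close>)
  qed
qed

lemma smooth_on_add:
  "open S \<Longrightarrow> smooth_on S f \<Longrightarrow> smooth_on S g \<Longrightarrow> smooth_on S (\<lambda>x. f x + g x)"
  by (simp add: smooth_on_def times_differentiable_on_add)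

text \<open>The Leibniz rule pairs a derivative, controlled to order \<open>n\<close>, with an
  undifferentiated factor controlled to order \<open>Suc n\<close>. Lowering the order of the latter
  makes the induction hypothesis for products applicable.\<close>

lemma times_differentiable_on_SucD:
  "times_differentiable_on (Suc n) S f \<Longrightarrow> times_differentiable_on n S f"
proof (induction n arbitrary: f)
  case 0
  then show ?case
    by (meson continuous_at_imp_continuous_on differentiable_imp_continuous_within
        times_differentiable_on.simps(1) times_differentiable_on_Suc_iff)
qed (auto simp: times_differentiable_on_Suc_iff)

lemma (in bounded_bilinear) times_differentiable_on_prod:
  assumes "open S" "times_differentiable_on n S f" "times_differentiable_on n S g"
  shows "times_differentiable_on n S (\<lambda>x. prod (f x) (g x))"
  using assms(2,3)
proof (induction n arbitrary: f g)
  case 0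
  then show ?case by (simp add: continuous_on)
next
  case (Suc n)
  show ?case
  proof (intro times_differentiable_on_SucI ballI allI)
    fix x assume "x \<in> S"
    with Suc.prems show "(\<lambda>x. prod (f x) (g x)) differentiable (at x)"
      by (simp add: differentiable_prod times_differentiable_on_Suc_iff)
  next
    fix v
    show "times_differentiable_on n S (dir_deriv v (\<lambda>x. prod (f x) (g x)))"
    proof (rule times_differentiable_on_cong[OF assms(1)])
      show "times_differentiable_on n S
        (\<lambda>x. prod (f x) (dir_deriv v g x) + prod (dir_deriv v f x) (g x))"
        using Suc.prems times_differentiable_on_SucD[of n S f] times_differentiable_on_SucD[of n S g]
        by (intro times_differentiable_on_add assms(1) Suc.IH) (auto simp: times_differentiable_on_Suc_iff)
    qed (use Suc.prems in \<open>simp add: vf_apply_prod times_differentiable_on_Suc_iff\<close>)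
  qed
qed

lemma (in bounded_bilinear) smooth_on_prod:
  "open S \<Longrightarrow> smooth_on S f \<Longrightarrow> smooth_on S g \<Longrightarrow> smooth_on S (\<lambda>x. prod (f x) (g x))"
  by (simp add: smooth_on_def times_differentiable_on_prod)

lemmas smooth_on_scaleR = bounded_bilinear.smooth_on_prod[OF bounded_bilinear_scaleR]
lemmas smooth_on_mult = bounded_bilinear.smooth_on_prod[OF bounded_bilinear_mult]

lemma smooth_on_minus: "open S \<Longrightarrow> smooth_on S f \<Longrightarrow> smooth_on S (\<lambda>x. - f x)"
  using smooth_on_scaleR[of S "\<lambda>_. -1" f] by (simp add: smooth_on_const)

lemma smooth_on_diff:
  "open S \<Longrightarrow> smooth_on S f \<Longrightarrow> smooth_on S g \<Longrightarrow> smooth_on S (\<lambda>x. f x - g x)"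
  using smooth_on_add[of S f "\<lambda>x. - g x"] by (simp add: smooth_on_minus)

text \<open>\<open>L (f x)\<close> is the product of the constant \<open>1\<close> with
  \<open>f x\<close> under the bounded bilinear map \<open>r *\<^sub>R L y\<close>, so the product
  rule already covers it.\<close>

lemma smooth_on_bounded_linear_compose:
  assumes "open S" "bounded_linear L" "smooth_on S f"
  shows "smooth_on S (\<lambda>x. L (f x))"
proof -
  interpret bounded_bilinear "\<lambda>(r::real) y. r *\<^sub>R L y"
    using bounded_bilinear.comp[OF bounded_bilinear_scaleR bounded_linear_ident assms(2)] by simp
  show ?thesis using smooth_on_prod[OF assms(1) smooth_on_const[of S 1] assms(3)] by simp
qed

lemma smooth_on_bounded_linear:
  assumes "bounded_linear L"
  shows "smooth_on S L"
proof -
  have "dir_deriv v L = (\<lambda>_. L v)" for v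
    by (rule ext) (metis assms bounded_linear_imp_has_derivative vf_apply_eqI)
  moreover have "L differentiable (at x)" for x
    using assms bounded_linear_imp_differentiable by blast
  moreover have "continuous_on S L"
    using assms linear_continuous_on by blast
  ultimately have "times_differentiable_on n S L" for n
    using smooth_on_const[of S]
    by (cases n) (auto simp: times_differentiable_on_Suc_iff smooth_on_def)
  then show ?thesis unfolding smooth_on_def by blast
qed

text \<open>The derivative of the reciprocal \<open>h\<close> is \<open>- dir_deriv v f\<close>
  times the square of \<open>h\<close>. It contains \<open>h\<close> but no derivative of
  \<open>h\<close>, so order \<open>n\<close> for \<open>h\<close> yields order
  \<open>Suc n\<close>.\<close>

lemma smooth_on_inverse:
  fixes f :: "'a::real_normed_vector \<Rightarrow> real"
  assumes "open S" "smooth_on S f" "\<And>x. x \<in> S \<Longrightarrow> f x \<noteq> 0"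
  shows "smooth_on S (\<lambda>x. inverse (f x))"
proof -
  define h where "h = (\<lambda>x. inverse (f x))"
  have diff: "h differentiable (at x)" if "x \<in> S" for x
    unfolding h_def by (intro differentiable_inverse smooth_on_differentiable[OF assms(2)] assms(3) that)
  have deriv: "- dir_deriv v f x * (h x * h x) = dir_deriv v h x" if "x \<in> S" for v x
    using Deriv.has_derivative_inverse[OF assms(3)[OF that] has_derivative_vf_apply[OF smooth_on_differentiable[OF assms(2) that]]]
    unfolding h_def by (simp add: vf_apply_eqI algebra_simps)
  have "times_differentiable_on n S h" for n
  proof (induction n)
    case 0
    show ?case
      using diff by (auto intro: continuous_at_imp_continuous_on differentiable_imp_continuous_within)
  next
    case (Suc n)
    show ?case
    proof (intro times_differentiable_on_SucI ballI allI diff)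
      fix v
      have "times_differentiable_on n S (\<lambda>x. - dir_deriv v f x)"
        using smooth_on_minus[OF assms(1) smooth_on_dir_deriv[OF assms(2)]] by (simp add: smooth_on_def)
      then have "times_differentiable_on n S (\<lambda>x. (- dir_deriv v f x) * (h x * h x))"
        by (intro bounded_bilinear.times_differentiable_on_prod[OF bounded_bilinear_mult] Suc assms(1))
      then show "times_differentiable_on n S (dir_deriv v h)"
        by (rule times_differentiable_on_cong[OF assms(1), rotated]) (rule deriv)
    qed
  qed
  then show ?thesis unfolding smooth_on_def h_def by blast
qed

lemma smooth_on_divide:
  fixes f g :: "'a::real_normed_vector \<Rightarrow> real"
  assumes "open S" "smooth_on S f" "smooth_on S g" "\<And>x. x \<in> S \<Longrightarrow> g x \<noteq> 0"
  shows "smooth_on S (\<lambda>x. f x / g x)"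
  unfolding divide_inverse by (intro smooth_on_mult smooth_on_inverse assms)

text \<open>The chain rule differentiates \<open>f\<close> in the direction
  \<open>dir_deriv v g x\<close>, which varies with \<open>x\<close>, whereas the recursion controls
  derivatives in fixed directions. Expanding the direction over \<open>Basis\<close> repairs this,
  which is why the middle space is Euclidean.\<close>

lemma smooth_on_compose:
  fixes g :: "'a::real_normed_vector \<Rightarrow> 'b::euclidean_space"
  assumes "open S" "smooth_on S g" "smooth_on T f" "g ` S \<subseteq> T"
  shows "smooth_on S (\<lambda>x. f (g x))"
proof -
  have "times_differentiable_on n S (\<lambda>x. f (g x))" for n
    using assms(3)
  proof (induction n arbitrary: f)
    case 0
    then show ?case
      using continuous_on_compose2[OF smooth_on_continuous[OF 0] smooth_on_continuous[OF assms(2)] assms(4)]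
      by simp
  next
    case (Suc n)
    have df: "f differentiable (at (g x))" and dg: "g differentiable (at x)" if "x \<in> S" for x
      using that assms(2,4) Suc.prems by (auto intro: smooth_on_differentiable)
    show ?case
    proof (intro times_differentiable_on_SucI ballI allI)
      fix x assume "x \<in> S"
      then show "(\<lambda>x. f (g x)) differentiable (at x)"
        using differentiable_chain_at[OF dg df] by (simp add: o_def)
    next
      fix v
      have "times_differentiable_on n S (\<lambda>x. dir_deriv v g x \<bullet> b)" for b
        using smooth_on_bounded_linear_compose[OF assms(1) bounded_linear_inner_left smooth_on_dir_deriv[OF assms(2)]]
        by (simp add: smooth_on_def)
      then have terms: "times_differentiable_on n S (\<lambda>x. (dir_deriv v g x \<bullet> b) *\<^sub>R dir_deriv b f (g x))" for b
        by (intro bounded_bilinear.times_differentiable_on_prod[OF bounded_bilinear_scaleR] assms(1)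
            Suc.IH smooth_on_dir_deriv Suc.prems)
      have "times_differentiable_on n S (\<lambda>x. \<Sum>b\<in>B. (dir_deriv v g x \<bullet> b) *\<^sub>R dir_deriv b f (g x))"
        if "finite B" for B
        using that
      proof (induction B)
        case empty
        show ?case by (simp add: smooth_on_const[unfolded smooth_on_def])
      next
        case (insert b B)
        then show ?case by (simp add: times_differentiable_on_add[OF assms(1)] terms)
      qed
      then have "times_differentiable_on n S (\<lambda>x. \<Sum>b\<in>Basis. (dir_deriv v g x \<bullet> b) *\<^sub>R dir_deriv b f (g x))"
        by simp
      moreover have "(\<Sum>b\<in>Basis. (dir_deriv v g x \<bullet> b) *\<^sub>R dir_deriv b f (g x)) = dir_deriv v (\<lambda>x. f (g x)) x"
        if "x \<in> S" for x
      proof -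
        have "dir_deriv v (\<lambda>x. f (g x)) x = dir_deriv (\<Sum>b\<in>Basis. (dir_deriv v g x \<bullet> b) *\<^sub>R b) f (g x)"
          by (simp add: vf_apply_compose[OF df[OF that] dg[OF that]] euclidean_representation)
        also have "\<dots> = (\<Sum>b\<in>Basis. (dir_deriv v g x \<bullet> b) *\<^sub>R dir_deriv b f (g x))"
          by (simp add: linear_sum[OF linear_vf_apply[OF df[OF that]]] linear_cmul[OF linear_vf_apply[OF df[OF that]]])
        finally show ?thesis by simp
      qed
      ultimately show "times_differentiable_on n S (dir_deriv v (\<lambda>x. f (g x)))"
        by (rule times_differentiable_on_cong[OF assms(1), rotated])
    qed
  qed
  then show ?thesis unfolding smooth_on_def by blast
qed

section \<open>Symmetry of second derivatives\<close>

text \<open>Two applications of the mean value theorem, in direction \<open>v\<close> to a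
  difference of values of \<open>f\<close> and then in direction \<open>w\<close> to
  \<open>dir_deriv v f\<close>, express the second difference as \<open>t * t\<close> times the
  mixed derivative at an intermediate point. Continuity of that derivative compares it with its
  value at \<open>p\<close>.\<close>

lemma second_difference_estimate:
  fixes f :: "'a::real_normed_vector \<Rightarrow> real"
  assumes "open S" "p \<in> S" "smooth_on S f" "e > 0"
  shows "\<exists>d>0. \<forall>t. 0 < t \<and> t < d \<longrightarrow>
    \<bar>f (p + t *\<^sub>R v + t *\<^sub>R w) - f (p + t *\<^sub>R v) - f (p + t *\<^sub>R w) + f p
      - t * (t * dir_deriv w (dir_deriv v f) p)\<bar> \<le> t * (t * e)"
proof -
  have "continuous_on S (dir_deriv w (dir_deriv v f))"
    using assms by (intro smooth_on_continuous smooth_on_dir_deriv)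
  then have "isCont (dir_deriv w (dir_deriv v f)) p"
    using assms by (simp add: continuous_on_eq_continuous_at)
  then obtain r1 where r1: "r1 > 0"
    "\<And>x. dist x p < r1 \<Longrightarrow> dist (dir_deriv w (dir_deriv v f) x) (dir_deriv w (dir_deriv v f) p) < e"
    using assms(4) unfolding continuous_at_eps_delta by (auto simp: dist_norm)
  obtain r2 where r2: "r2 > 0" "ball p r2 \<subseteq> S"
    using assms openE by blast
  define r where "r = min r1 r2"
  have r: "r > 0" using r1 r2 by (simp add: r_def)
  \<comment> \<open>The \<open>+ 1\<close> keeps the bound on \<open>t\<close> positive when
    \<open>v\<close> and \<open>w\<close> both vanish.\<close>
  have near: "norm (a *\<^sub>R v + b *\<^sub>R w) < r"
    if "0 \<le> a" "a \<le> t" "0 \<le> b" "b \<le> t" "t < r / (norm v + norm w + 1)" for a b t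
  proof -
    have "norm (a *\<^sub>R v + b *\<^sub>R w) \<le> a * norm v + b * norm w"
      using norm_triangle_ineq[of "a *\<^sub>R v" "b *\<^sub>R w"] that by simp
    also have "\<dots> \<le> t * norm v + t * norm w"
      using that by (intro add_mono mult_right_mono) auto
    also have "\<dots> \<le> t * (norm v + norm w + 1)"
      using that by (simp add: algebra_simps)
    also have "\<dots> < r"
      using that(5) by (simp add: pos_less_divide_eq add_nonneg_pos)
    finally show ?thesis .
  qed
  have inS: "p + a *\<^sub>R v + b *\<^sub>R w \<in> S"
    if "0 \<le> a" "a \<le> t" "0 \<le> b" "b \<le> t" "t < r / (norm v + norm w + 1)" for a b t
  proof -
    have "p + (a *\<^sub>R v + b *\<^sub>R w) \<in> ball p r2"
      using near[OF that] by (simp add: dist_norm r_def norm_minus_commute add.commute)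
    then show ?thesis using r2 by (auto simp: add.assoc)
  qed
  have close: "\<bar>dir_deriv w (dir_deriv v f) (p + a *\<^sub>R v + b *\<^sub>R w) - dir_deriv w (dir_deriv v f) p\<bar> < e"
    if "0 \<le> a" "a \<le> t" "0 \<le> b" "b \<le> t" "t < r / (norm v + norm w + 1)" for a b t
    using r1(2)[of "p + (a *\<^sub>R v + b *\<^sub>R w)"] near[OF that] by (simp add: dist_norm r_def add.assoc)
  have line: "((\<lambda>s. h (q + s *\<^sub>R u)) has_real_derivative dir_deriv u h (q + s *\<^sub>R u)) (at s)"
    if "h differentiable (at (q + s *\<^sub>R u))" for h :: "'a \<Rightarrow> real" and q u s
  proof -
    have "((\<lambda>s. q + s *\<^sub>R u) has_derivative (\<lambda>k. k *\<^sub>R u)) (at s)"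
      by (auto intro!: derivative_eq_intros)
    from has_derivative_compose[OF this has_derivative_vf_apply[OF that]]
    have "((\<lambda>s. h (q + s *\<^sub>R u)) has_derivative (\<lambda>k. k * dir_deriv u h (q + s *\<^sub>R u))) (at s)"
      using linear_cmul[OF linear_vf_apply[OF that]] by simp
    then show ?thesis by (simp add: has_field_derivative_def mult.commute[of _ "dir_deriv u h (q + s *\<^sub>R u)"])
  qed
  have diff: "smooth_on S h \<Longrightarrow> x \<in> S \<Longrightarrow> h differentiable (at x)" for h :: "'a \<Rightarrow> real" and x
    by (rule smooth_on_differentiable)
  show ?thesis
  proof (intro exI conjI allI impI)
    show "0 < r / (norm v + norm w + 1)" using r by (simp add: add_nonneg_pos)
    fix t assume t: "0 < t \<and> t < r / (norm v + norm w + 1)"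
    define \<phi> where "\<phi> = (\<lambda>s. f (p + t *\<^sub>R w + s *\<^sub>R v) - f (p + s *\<^sub>R v))"
    have d\<phi>: "(\<phi> has_real_derivative
        dir_deriv v f (p + t *\<^sub>R w + s *\<^sub>R v) - dir_deriv v f (p + s *\<^sub>R v)) (at s)"
      if "0 \<le> s" "s \<le> t" for s
      unfolding \<phi>_def
      using inS[of s t t] inS[of s t 0] that t
      by (intro DERIV_diff line diff assms) (auto simp: algebra_simps)
    obtain s where s: "0 < s" "s < t" and \<phi>s: "\<phi> t - \<phi> 0
        = (t - 0) * (dir_deriv v f (p + t *\<^sub>R w + s *\<^sub>R v) - dir_deriv v f (p + s *\<^sub>R v))"
      using MVT2[of 0 t \<phi> "\<lambda>s. dir_deriv v f (p + t *\<^sub>R w + s *\<^sub>R v) - dir_deriv v f (p + s *\<^sub>R v)"] d\<phi> t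
      by auto
    define \<psi> where "\<psi> = (\<lambda>b. dir_deriv v f (p + s *\<^sub>R v + b *\<^sub>R w))"
    have d\<psi>: "(\<psi> has_real_derivative dir_deriv w (dir_deriv v f) (p + s *\<^sub>R v + b *\<^sub>R w)) (at b)"
      if "0 \<le> b" "b \<le> t" for b
      unfolding \<psi>_def using inS[of s t b] that t s
      by (intro line diff smooth_on_dir_deriv assms) auto
    obtain b where b: "0 < b" "b < t" and \<psi>b: "\<psi> t - \<psi> 0
        = (t - 0) * dir_deriv w (dir_deriv v f) (p + s *\<^sub>R v + b *\<^sub>R w)"
      using MVT2[of 0 t \<psi> "\<lambda>b. dir_deriv w (dir_deriv v f) (p + s *\<^sub>R v + b *\<^sub>R w)"] d\<psi> t
      by auto
    have "f (p + t *\<^sub>R v + t *\<^sub>R w) - f (p + t *\<^sub>R v) - f (p + t *\<^sub>R w) + f p = \<phi> t - \<phi> 0"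
      by (simp add: \<phi>_def algebra_simps)
    also have "\<dots> = t * (\<psi> t - \<psi> 0)"
      using \<phi>s by (simp add: \<psi>_def algebra_simps)
    also have "\<dots> = t * (t * dir_deriv w (dir_deriv v f) (p + s *\<^sub>R v + b *\<^sub>R w))"
      using \<psi>b by simp
    finally have "f (p + t *\<^sub>R v + t *\<^sub>R w) - f (p + t *\<^sub>R v) - f (p + t *\<^sub>R w) + f p
        - t * (t * dir_deriv w (dir_deriv v f) p)
      = t * (t * (dir_deriv w (dir_deriv v f) (p + s *\<^sub>R v + b *\<^sub>R w) - dir_deriv w (dir_deriv v f) p))"
      by (simp add: algebra_simps)
    then have "\<bar>f (p + t *\<^sub>R v + t *\<^sub>R w) - f (p + t *\<^sub>R v) - f (p + t *\<^sub>R w) + f p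
        - t * (t * dir_deriv w (dir_deriv v f) p)\<bar>
      = t * (t * \<bar>dir_deriv w (dir_deriv v f) (p + s *\<^sub>R v + b *\<^sub>R w) - dir_deriv w (dir_deriv v f) p\<bar>)"
      using t by (simp only: abs_mult abs_of_pos)
    also have "\<dots> \<le> t * (t * e)"
      using close[of s t b] s b t by (intro mult_left_mono) auto
    finally show "\<bar>f (p + t *\<^sub>R v + t *\<^sub>R w) - f (p + t *\<^sub>R v) - f (p + t *\<^sub>R w) + f p
        - t * (t * dir_deriv w (dir_deriv v f) p)\<bar> \<le> t * (t * e)" .
  qed
qed

text \<open>The second difference is symmetric in \<open>v\<close> and \<open>w\<close>, so both
  mixed derivatives approximate the same number, each with error \<open>e / 2\<close> after division
  by \<open>t * t\<close>.\<close>

lemma dir_deriv_commute_real: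
  fixes f :: "'a::real_normed_vector \<Rightarrow> real"
  assumes "open S" "p \<in> S" "smooth_on S f"
  shows "dir_deriv v (dir_deriv w f) p = dir_deriv w (dir_deriv v f) p"
proof -
  have "\<bar>dir_deriv w (dir_deriv v f) p - dir_deriv v (dir_deriv w f) p\<bar> \<le> 0 + e" if "e > 0" for e
  proof -
    obtain d1 where d1: "d1 > 0" "\<And>t. 0 < t \<Longrightarrow> t < d1 \<Longrightarrow>
      \<bar>f (p + t *\<^sub>R v + t *\<^sub>R w) - f (p + t *\<^sub>R v) - f (p + t *\<^sub>R w) + f p
        - t * (t * dir_deriv w (dir_deriv v f) p)\<bar> \<le> t * (t * (e / 2))"
      using second_difference_estimate[OF assms, of "e / 2" v w] \<open>e > 0\<close> by (metis half_gt_zero)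
    obtain d2 where d2: "d2 > 0" "\<And>t. 0 < t \<Longrightarrow> t < d2 \<Longrightarrow>
      \<bar>f (p + t *\<^sub>R w + t *\<^sub>R v) - f (p + t *\<^sub>R w) - f (p + t *\<^sub>R v) + f p
        - t * (t * dir_deriv v (dir_deriv w f) p)\<bar> \<le> t * (t * (e / 2))"
      using second_difference_estimate[OF assms, of "e / 2" w v] \<open>e > 0\<close> by (metis half_gt_zero)
    define t where "t = min d1 d2 / 2"
    have t: "0 < t" "t < d1" "t < d2" using d1(1) d2(1) by (auto simp: t_def)
    have swap: "p + t *\<^sub>R w + t *\<^sub>R v = p + t *\<^sub>R v + t *\<^sub>R w" by simp
    have "\<bar>t * (t * dir_deriv w (dir_deriv v f) p) - t * (t * dir_deriv v (dir_deriv w f) p)\<bar>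
        \<le> t * (t * (e / 2)) + t * (t * (e / 2))"
      using d1(2)[OF t(1,2)] d2(2)[OF t(1,3)] unfolding swap by linarith
    then have "t * (t * \<bar>dir_deriv w (dir_deriv v f) p - dir_deriv v (dir_deriv w f) p\<bar>) \<le> t * (t * e)"
      using t(1) by (simp flip: right_diff_distrib distrib_left add: abs_mult)
    then show ?thesis using t(1) by simp
  qed
  then show ?thesis
    using field_le_epsilon[of "\<bar>dir_deriv w (dir_deriv v f) p - dir_deriv v (dir_deriv w f) p\<bar>" 0] by simp
qed

lemma dir_deriv_commute:
  fixes f :: "'a::real_normed_vector \<Rightarrow> 'b::euclidean_space"
  assumes "open S" "p \<in> S" "smooth_on S f"
  shows "dir_deriv v (dir_deriv w f) p = dir_deriv w (dir_deriv v f) p"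
proof (rule euclidean_eqI)
  fix b :: 'b
  have eq: "dir_deriv v (dir_deriv w f) p \<bullet> b = dir_deriv v (dir_deriv w (\<lambda>x. f x \<bullet> b)) p" for v w
  proof -
    have "dir_deriv v (dir_deriv w f) p \<bullet> b = dir_deriv v (\<lambda>x. dir_deriv w f x \<bullet> b) p"
      using vf_apply_bounded_linear[OF bounded_linear_inner_left
          smooth_on_differentiable[OF smooth_on_dir_deriv[OF assms(3)] assms(2)]] by metis
    also have "\<dots> = dir_deriv v (dir_deriv w (\<lambda>x. f x \<bullet> b)) p"
      using vf_apply_bounded_linear[OF bounded_linear_inner_left smooth_on_differentiable[OF assms(3)]]
      by (intro vf_apply_cong[OF assms(1,2)]) metis
    finally show ?thesis .
  qed
  show "dir_deriv v (dir_deriv w f) p \<bullet> b = dir_deriv w (dir_deriv v f) p \<bullet> b"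
    unfolding eq
    by (rule dir_deriv_commute_real[OF assms(1,2)
          smooth_on_bounded_linear_compose[OF assms(1) bounded_linear_inner_left assms(3)]])
qed

definition det2 :: "real \<times> real \<Rightarrow> real \<times> real \<Rightarrow> real" where
  "det2 v w = fst v * snd w - snd v * fst w"

lemma bounded_bilinear_det2: "bounded_bilinear det2"
  unfolding bilinear_conv_bounded_bilinear[symmetric] bilinear_def
  by (auto intro!: linearI simp: det2_def algebra_simps)

lemmas det2_simps =
  bounded_bilinear.add_left[OF bounded_bilinear_det2] bounded_bilinear.add_right[OF bounded_bilinear_det2]
  bounded_bilinear.diff_left[OF bounded_bilinear_det2] bounded_bilinear.diff_right[OF bounded_bilinear_det2]
  bounded_bilinear.minus_left[OF bounded_bilinear_det2] bounded_bilinear.minus_right[OF bounded_bilinear_det2]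
  bounded_bilinear.scaleR_left[OF bounded_bilinear_det2] bounded_bilinear.scaleR_right[OF bounded_bilinear_det2]

lemma det2_self [simp]: "det2 v v = 0"
  by (simp add: det2_def)

text \<open>Cramer's rule without division: it holds for dependent \<open>v\<close> and
  \<open>w\<close> too, and gives frame coefficients once the determinant is known to be
  nonzero.\<close>

lemma cramer: "det2 v w *\<^sub>R u = det2 u w *\<^sub>R v + det2 v u *\<^sub>R w"
  by (simp add: det2_def prod_eq_iff algebra_simps)

lemma vector_derivative_eq_dir_deriv:
  "f differentiable (at s) \<Longrightarrow> vector_derivative f (at s) = dir_deriv 1 f s"
  by (simp add: vf_apply_def frechet_derivative_eq_vector_derivative)

section \<open>The vector field of the equation and its invariants\<close>

lemma bounded_linear_jet_x1: "bounded_linear jet_x1"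
  unfolding jet_x1_def by (intro bounded_linear_intros)

lemma jet_x1_simps [simp]: "jet_x1 e_t = 0" "jet_x1 e_0 = 0" "jet_x1 e_1 = 1"
  by (simp_all add: jet_x1_def e_t_def e_0_def e_1_def)

lemma vf_apply_jet_x1: "vf_apply Y jet_x1 p = jet_x1 (Y p)"
  using vf_apply_eqI[OF bounded_linear_imp_has_derivative[OF bounded_linear_jet_x1]] .

lemma jet_x1_X_field [simp]: "jet_x1 (X_field F p) = F p"
  by (simp add: X_field_def jet_x1_def e_t_def e_0_def e_1_def)

lemma dir_deriv_add:
  "f differentiable (at p) \<Longrightarrow> dir_deriv (v + w) f p = dir_deriv v f p + dir_deriv w f p"
  using linear_add[OF linear_vf_apply] .

lemma dir_deriv_scaleR:
  "f differentiable (at p) \<Longrightarrow> dir_deriv (c *\<^sub>R v) f p = c *\<^sub>R dir_deriv v f p"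
  using linear_cmul[OF linear_vf_apply] .

lemma vf_apply_divide_const:
  fixes f :: "'a::real_normed_vector \<Rightarrow> real"
  shows "f differentiable (at p) \<Longrightarrow> vf_apply Y (\<lambda>x. f x / c) p = vf_apply Y f p / c"
  using vf_apply_bounded_linear[OF bounded_linear_divide] .

lemma smooth_on_divide_const:
  fixes f :: "'a::real_normed_vector \<Rightarrow> real"
  shows "open S \<Longrightarrow> smooth_on S f \<Longrightarrow> smooth_on S (\<lambda>x. f x / c)"
  using smooth_on_bounded_linear_compose[OF _ bounded_linear_divide] .

lemma vf_apply_linear_combination:
  assumes "f differentiable (at p)"
  shows "vf_apply (\<lambda>q. a q *\<^sub>R Y q + b q *\<^sub>R Z q) f p = a p *\<^sub>R vf_apply Y f p + b p *\<^sub>R vf_apply Z f p"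
  using vf_apply_eq_dir_deriv[of Y f p] vf_apply_eq_dir_deriv[of Z f p]
    vf_apply_eq_dir_deriv[of "\<lambda>q. a q *\<^sub>R Y q + b q *\<^sub>R Z q" f p]
  by (simp add: dir_deriv_add dir_deriv_scaleR assms)

locale ode =
  fixes F :: "jet \<Rightarrow> real" and U :: "jet set"
  assumes open_U: "open U" and smooth_F: "smooth_on U F"
begin

abbreviation X :: "(jet \<Rightarrow> 'b::real_normed_vector) \<Rightarrow> jet \<Rightarrow> 'b"
  where "X \<equiv> vf_apply (X_field F)"

abbreviation "F_0 \<equiv> dir_deriv e_0 F"
abbreviation "F_1 \<equiv> dir_deriv e_1 F"
abbreviation "F_00 \<equiv> dir_deriv e_0 (dir_deriv e_0 F)"
abbreviation "F_01 \<equiv> dir_deriv e_0 (dir_deriv e_1 F)"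
abbreviation "F_11 \<equiv> dir_deriv e_1 (dir_deriv e_1 F)"

lemma X_eq:
  assumes "f differentiable (at p)"
  shows "X f p = dir_deriv e_t f p + jet_x1 p *\<^sub>R dir_deriv e_0 f p + F p *\<^sub>R dir_deriv e_1 f p"
  using vf_apply_eq_dir_deriv[of "X_field F" f p]
  by (simp add: X_field_def dir_deriv_add dir_deriv_scaleR assms)

lemmas smooth_diff = smooth_on_differentiable[of U]

lemma smooth_on_X:
  assumes "smooth_on U f"
  shows "smooth_on U (X f)"
proof (rule smooth_on_cong[OF open_U])
  show "smooth_on U (\<lambda>p. dir_deriv e_t f p + jet_x1 p *\<^sub>R dir_deriv e_0 f p + F p *\<^sub>R dir_deriv e_1 f p)"
    by (intro smooth_on_add smooth_on_scaleR smooth_on_dir_deriv open_U assms smooth_F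
        smooth_on_bounded_linear bounded_linear_jet_x1)
qed (simp add: X_eq smooth_diff[OF assms])

lemmas smooth_rules = smooth_F smooth_on_X smooth_on_dir_deriv smooth_on_const
  smooth_on_add[OF open_U] smooth_on_diff[OF open_U] smooth_on_minus[OF open_U]
  smooth_on_mult[OF open_U] smooth_on_scaleR[OF open_U]
  smooth_on_bounded_linear[OF bounded_linear_jet_x1, of U]
  smooth_on_divide_const[OF open_U]

text \<open>The smoothness rules are included so that the simplifier can discharge the
  differentiability conditions of the Leibniz rules by itself.\<close>

lemmas deriv_rules = vf_apply_add vf_apply_diff vf_apply_minus vf_apply_mult vf_apply_scaleR
  vf_apply_divide_const vf_apply_jet_x1 smooth_diff smooth_rules

lemma vf_apply_cong_U: "p \<in> U \<Longrightarrow> (\<And>q. q \<in> U \<Longrightarrow> f q = g q) \<Longrightarrow> vf_apply Y f p = vf_apply Y g p"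
  by (rule vf_apply_cong[OF open_U])

text \<open>The coefficients of \<open>X_field F\<close> are 1, \<open>jet_x1\<close> and
  \<open>F\<close>. Commuting a constant direction past \<open>X\<close> differentiates just these,
  because second derivatives of \<open>f\<close> are symmetric.\<close>

lemma dir_deriv_X:
  fixes f :: "jet \<Rightarrow> 'b::euclidean_space"
  assumes "smooth_on U f" "p \<in> U"
  shows "dir_deriv v (X f) p
    = X (dir_deriv v f) p + jet_x1 v *\<^sub>R dir_deriv e_0 f p + dir_deriv v F p *\<^sub>R dir_deriv e_1 f p"
proof -
  have "dir_deriv v (X f) p
      = dir_deriv v (\<lambda>p. dir_deriv e_t f p + jet_x1 p *\<^sub>R dir_deriv e_0 f p + F p *\<^sub>R dir_deriv e_1 f p) p"
    by (rule vf_apply_cong_U) (simp_all add: X_eq smooth_diff assms)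
  also have "\<dots> = dir_deriv e_t (dir_deriv v f) p + jet_x1 p *\<^sub>R dir_deriv e_0 (dir_deriv v f) p
      + F p *\<^sub>R dir_deriv e_1 (dir_deriv v f) p
      + jet_x1 v *\<^sub>R dir_deriv e_0 f p + dir_deriv v F p *\<^sub>R dir_deriv e_1 f p"
    using assms
    by (simp add: deriv_rules dir_deriv_commute[OF open_U assms(2,1), of v])
  finally show ?thesis
    by (simp add: X_eq smooth_diff smooth_on_dir_deriv assms)
qed

lemma dir_deriv_commute_U:
  fixes f :: "jet \<Rightarrow> 'b::euclidean_space"
  shows "smooth_on U f \<Longrightarrow> p \<in> U \<Longrightarrow> dir_deriv v (dir_deriv w f) p = dir_deriv w (dir_deriv v f) p"
  using dir_deriv_commute[OF open_U] by blast

text \<open>The Cartan invariant with all derivatives along \<open>t\<close> absorbed into \<open>X\<close>.\<close>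

definition reduced_cartan :: "jet \<Rightarrow> real" where
  "reduced_cartan p = F_00 p - 1/2 * F_0 p * F_11 p - 2/3 * X F_01 p + 1/6 * X (X F_11) p
     + 2/3 * F_1 p * F_01 p - 1/6 * F_1 p * X F_11 p"

text \<open>Iterating \<open>X\<close> also differentiates its coefficients, with
  \<open>X jet_x1 = F\<close>. So \<open>F * dir_deriv e_0 F_11\<close> occurs with
  \<open>1/6\<close> in the term with \<open>X (X F_11)\<close> and with \<open>- 2/3\<close> in the
  one with \<open>X F_01\<close>, together \<open>- 1/2\<close>. The multiples of
  \<open>F * F_1 * dir_deriv e_1 F_11\<close> from \<open>X (X F_11)\<close> and
  \<open>F_1 * X F_11\<close> cancel.\<close>

lemma cartan_invariant_eq_reduced_cartan:
  assumes p: "p \<in> U"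
  shows "cartan_invariant F p = reduced_cartan p"
proof -
  have X_F01: "X F_01 p = dir_deriv e_t F_01 p + jet_x1 p * dir_deriv e_0 F_01 p + F p * dir_deriv e_0 F_11 p"
    using dir_deriv_commute_U[of F_1 p e_1 e_0] p by (simp add: X_eq deriv_rules)
  have XX: "X (X G) p =
        dir_deriv e_t (dir_deriv e_t G) p + 2 * jet_x1 p * dir_deriv e_t (dir_deriv e_0 G) p
      + 2 * F p * dir_deriv e_t (dir_deriv e_1 G) p + (jet_x1 p)\<^sup>2 * dir_deriv e_0 (dir_deriv e_0 G) p
      + 2 * jet_x1 p * F p * dir_deriv e_0 (dir_deriv e_1 G) p
      + (F p)\<^sup>2 * dir_deriv e_1 (dir_deriv e_1 G) p + F p * dir_deriv e_0 G p
      + (dir_deriv e_t F p + jet_x1 p * F_0 p + F p * F_1 p) * dir_deriv e_1 G p"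
    if G: "smooth_on U G" for G :: "jet \<Rightarrow> real"
  proof -
    have "X (X G) p = X (\<lambda>p. dir_deriv e_t G p + jet_x1 p * dir_deriv e_0 G p + F p * dir_deriv e_1 G p) p"
      by (rule vf_apply_cong_U[OF p]) (simp add: X_eq smooth_diff G)
    also have "\<dots> = X (dir_deriv e_t G) p + (jet_x1 p * X (dir_deriv e_0 G) p + F p * dir_deriv e_0 G p)
        + (F p * X (dir_deriv e_1 G) p + X F p * dir_deriv e_1 G p)"
      using p G by (simp add: deriv_rules)
    finally show ?thesis
      using p G dir_deriv_commute_U[OF G p, of e_0 e_t] dir_deriv_commute_U[OF G p, of e_1 e_t]
        dir_deriv_commute_U[OF G p, of e_1 e_0]
      by (simp add: X_eq deriv_rules power2_eq_square algebra_simps)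
  qed
  have X_F11: "X F_11 p = dir_deriv e_t F_11 p + jet_x1 p * dir_deriv e_0 F_11 p + F p * dir_deriv e_1 F_11 p"
    using p by (simp add: X_eq deriv_rules)
  have "smooth_on U F_11" by (simp add: smooth_rules)
  then show ?thesis
    unfolding cartan_invariant_def reduced_cartan_def pd_t_def pd_0_def pd_1_def Let_def
    by (simp add: XX X_F01 X_F11 algebra_simps)
qed

text \<open>Write \<open>K_0\<close>, \<open>K_1\<close> for the derivatives of \<open>K\<close>.
  Commuting \<open>e_1\<close> past \<open>X\<close> turns the second summand into
  \<open>X K_1 + K_0 + F_1 * K_1\<close>, and the first is \<open>- 4 * K_0 - 2 * F_1 * K_1\<close>.
  The sum \<open>X K_1 - 3 * K_0 - F_1 * K_1\<close> contains \<open>3 * F_00\<close>, which is the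
  source of the factor 3.\<close>

lemma obstruction_explicit_eq:
  assumes p: "p \<in> U"
  shows "obstruction F V_explicit (V'_explicit F) (K0 F) p = 3 * reduced_cartan p"
proof -
  let ?K = "K0 F"
  have K: "?K = (\<lambda>p. - F_0 p + 1/2 * X F_1 p - 1/4 * (F_1 p * F_1 p))"
    by (simp add: K0_def pd_0_def pd_1_def power2_eq_square)
  have smooth_K: "smooth_on U ?K"
    unfolding K by (simp add: smooth_rules)
  have K_1: "dir_deriv e_1 ?K q = - 1/2 * F_01 q + 1/2 * X F_11 q" if "q \<in> U" for q
    unfolding K using that dir_deriv_commute_U[OF smooth_F that, of e_1 e_0]
    by (simp add: deriv_rules dir_deriv_X algebra_simps)
  have K_0: "dir_deriv e_0 ?K p = - F_00 p + 1/2 * (X F_01 p + F_0 p * F_11 p) - 1/2 * F_1 p * F_01 p"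
    unfolding K using p by (simp add: deriv_rules dir_deriv_X algebra_simps)
  have "X (dir_deriv e_1 ?K) p = X (\<lambda>q. - 1/2 * F_01 q + 1/2 * X F_11 q) p"
    by (rule vf_apply_cong_U[OF p K_1])
  then have XK_1: "X (dir_deriv e_1 ?K) p = - 1/2 * X F_01 p + 1/2 * X (X F_11) p"
    using p by (simp add: deriv_rules)
  have "vf_apply (V'_explicit F) ?K p = - dir_deriv e_0 ?K p - 1/2 * F_1 p * dir_deriv e_1 ?K p"
    using vf_apply_linear_combination[OF smooth_diff[OF smooth_K p], of "\<lambda>_. -1" "\<lambda>_. e_0" "\<lambda>p. - (1/2 * F_1 p)" "\<lambda>_. e_1"]
    by (simp add: V'_explicit_def pd_1_def)
  moreover have "vf_apply V_explicit (X ?K) p = X (dir_deriv e_1 ?K) p + dir_deriv e_0 ?K p + F_1 p * dir_deriv e_1 ?K p"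
    using dir_deriv_X[OF smooth_K p, of e_1] by (simp add: V_explicit_def)
  ultimately show ?thesis
    unfolding obstruction_def reduced_cartan_def by (simp add: K_1[OF p] K_0 XK_1 algebra_simps)
qed

section \<open>Independence of the scaling function\<close>

lemma dir_deriv_X_field:
  assumes "p \<in> U"
  shows "dir_deriv v (X_field F) p = jet_x1 v *\<^sub>R e_0 + dir_deriv v F p *\<^sub>R e_1"
  unfolding X_field_def using assms by (simp add: deriv_rules)

text \<open>The bracket is \<open>X g\<close> times \<open>e_1\<close> minus \<open>g\<close> times
  \<open>e_0 + F_1 e_1\<close>. The scaling equation replaces \<open>X g\<close> by
  \<open>g * F_1 / 2\<close>, which leaves half of the \<open>F_1\<close> term.\<close>

lemma V'_field_eq:
  assumes "scaling F U g" "p \<in> U"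
  shows "V'_field F g p = g p *\<^sub>R V'_explicit F p"
proof -
  have g: "smooth_on U g" "X g p = g p / 2 * F_1 p"
    using assms by (auto simp: scaling_def pd_1_def)
  have X_V: "X (V_field g) p = X g p *\<^sub>R e_1"
    using g(1) assms(2) by (simp add: V_field_def deriv_rules)
  have "X_field F differentiable (at p)"
    unfolding X_field_def using assms(2) by (intro smooth_diff[of _ p]) (simp_all add: smooth_rules)
  then have "dir_deriv (g p *\<^sub>R e_1) (X_field F) p = g p *\<^sub>R (e_0 + F_1 p *\<^sub>R e_1)"
    by (simp only: dir_deriv_scaleR) (simp add: dir_deriv_X_field[OF assms(2)])
  moreover have "vf_apply (V_field g) (X_field F) p = dir_deriv (g p *\<^sub>R e_1) (X_field F) p"
    by (simp add: vf_apply_def V_field_def)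
  ultimately show ?thesis
    unfolding V'_field_def lie_bracket_def X_V g(2)
    by (simp add: V'_explicit_def pd_1_def e_0_def e_1_def algebra_simps)
qed

text \<open>The scaling equation makes the \<open>e_0\<close> component of the double bracket
  vanish, so that the bracket is a multiple of \<open>V_field g\<close> at all. Its
  \<open>e_1\<close> component, divided by the nonzero \<open>g\<close>, is minus
  \<open>K0 F\<close>.\<close>

lemma is_K0_unique:
  assumes "scaling F U g" "is_K0 F U g K" "p \<in> U"
  shows "K p = K0 F p"
proof -
  have g: "smooth_on U g" "X g p = g p / 2 * F_1 p" "g p \<noteq> 0"
    using assms by (auto simp: scaling_def pd_1_def)
  have "X (V'_field F g) p = X (\<lambda>q. - (g q *\<^sub>R e_0) - (g q * F_1 q) *\<^sub>R ((1/2) *\<^sub>R e_1)) p"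
    by (rule vf_apply_cong_U[OF assms(3)])
      (simp add: V'_field_eq[OF assms(1)] V'_explicit_def pd_1_def algebra_simps)
  also have "\<dots> = - (X g p *\<^sub>R e_0) - (X g p * F_1 p + g p * X F_1 p) *\<^sub>R ((1/2) *\<^sub>R e_1)"
    using g(1) assms(3) by (simp add: deriv_rules add.commute mult.commute)
  finally have X_V': "X (V'_field F g) p
    = - (X g p *\<^sub>R e_0) - (X g p * F_1 p + g p * X F_1 p) *\<^sub>R ((1/2) *\<^sub>R e_1)" .
  have "vf_apply (V'_field F g) (X_field F) p
      = dir_deriv ((- g p) *\<^sub>R e_0 + (- (g p * F_1 p / 2)) *\<^sub>R e_1) (X_field F) p"
    by (simp add: vf_apply_def V'_field_eq[OF assms(1,3)] V'_explicit_def
        pd_1_def algebra_simps)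
  also have "\<dots> = (- g p) *\<^sub>R (F_0 p *\<^sub>R e_1) + (- (g p * F_1 p / 2)) *\<^sub>R (e_0 + F_1 p *\<^sub>R e_1)"
  proof -
    have "X_field F differentiable (at p)"
      unfolding X_field_def using assms(3) by (intro smooth_diff[of _ p]) (simp_all add: smooth_rules)
    then show ?thesis
      by (simp only: dir_deriv_add dir_deriv_scaleR) (simp add: dir_deriv_X_field[OF assms(3)])
  qed
  finally have "lie_bracket (X_field F) (V'_field F g) p
      = - (X g p *\<^sub>R e_0) - (X g p * F_1 p + g p * X F_1 p) *\<^sub>R ((1/2) *\<^sub>R e_1)
        - ((- g p) *\<^sub>R (F_0 p *\<^sub>R e_1) + (- (g p * F_1 p / 2)) *\<^sub>R (e_0 + F_1 p *\<^sub>R e_1))"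
    unfolding lie_bracket_def X_V' by simp
  also have "\<dots> = - K0 F p *\<^sub>R V_field g p"
    unfolding g(2) K0_def V_field_def pd_0_def pd_1_def e_0_def e_1_def
    by (simp add: algebra_simps power2_eq_square)
  finally have "K p *\<^sub>R V_field g p = K0 F p *\<^sub>R V_field g p"
    using assms(2,3) by (simp add: is_K0_def)
  then show ?thesis
    using g(3) by (simp add: V_field_def e_1_def)
qed

lemma vf_apply_scale_field:
  assumes "f differentiable (at p)" "Y p = c *\<^sub>R Z p"
  shows "vf_apply Y f p = c *\<^sub>R vf_apply Z f p"
  using dir_deriv_scaleR[OF assms(1), of c "Z p"] by (simp add: vf_apply_def assms(2))

lemma smooth_K0: "smooth_on U (K0 F)"
  unfolding K0_def pd_0_def pd_1_def power2_eq_square by (simp add: smooth_rules)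

text \<open>Neither \<open>V\<close> nor \<open>V'\<close> is differentiated in the obstruction:
  both only act on functions, as the outermost operators. A common factor of the two fields
  therefore comes out unchanged.\<close>

lemma obstruction_scaled:
  assumes "scaling F U g" "is_K0 F U g K" "p \<in> U"
  shows "obstruction F (V_field g) (V'_field F g) K p
       = g p * obstruction F V_explicit (V'_explicit F) (K0 F) p"
proof -
  note K = is_K0_unique[OF assms(1,2)]
  have "vf_apply (V'_field F g) K p = vf_apply (V'_field F g) (K0 F) p"
    by (rule vf_apply_cong_U[OF assms(3) K])
  also have "\<dots> = g p * vf_apply (V'_explicit F) (K0 F) p"
    using vf_apply_scale_field[of "K0 F" p "V'_field F g" "g p" "V'_explicit F"] V'_field_eq[OF assms(1,3)] smooth_K0 assms(3)
    by (simp add: smooth_diff)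
  finally have 1: "vf_apply (V'_field F g) K p = g p * vf_apply (V'_explicit F) (K0 F) p" .
  have "vf_apply (V_field g) (X K) p = vf_apply (V_field g) (X (K0 F)) p"
    by (intro vf_apply_cong_U assms(3) K)
  also have "\<dots> = g p * vf_apply V_explicit (X (K0 F)) p"
    using vf_apply_scale_field[of "X (K0 F)" p "V_field g" "g p" V_explicit] smooth_K0 assms(3)
    by (simp add: smooth_diff smooth_on_X V_field_def V_explicit_def)
  finally show ?thesis
    using 1 by (simp add: obstruction_def algebra_simps)
qed

end

section \<open>The frame on the solution space\<close>

locale solution_projection = ode F U for F :: "jet \<Rightarrow> real" and U :: "jet set" +
  fixes \<pi> :: "jet \<Rightarrow> real \<times> real"
  assumes sol: "solution_space F U \<pi>"
begin

lemma smooth_\<pi>: "smooth_on U \<pi>"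
  and surj_\<pi>: "p \<in> U \<Longrightarrow> surj (frechet_derivative \<pi> (at p))"
  and fibre_iff: "p \<in> U \<Longrightarrow> q \<in> U \<Longrightarrow> \<pi> p = \<pi> q \<longleftrightarrow> same_integral_curve U (X_field F) p q"
  using sol unfolding solution_space_def by auto

lemma has_vector_derivative_along_integral_curve:
  assumes "(c has_vector_derivative X_field F (c s)) (at s within T)" "f differentiable (at (c s))"
  shows "((\<lambda>s. f (c s)) has_vector_derivative X f (c s)) (at s within T)"
proof -
  have "((\<lambda>s. f (c s)) has_derivative (\<lambda>h. dir_deriv (h *\<^sub>R X_field F (c s)) f (c s))) (at s within T)"
    using has_derivative_compose[OF assms(1)[unfolded has_vector_derivative_def] has_derivative_vf_apply[OF assms(2)]] .
  then show ?thesis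
    by (simp add: has_vector_derivative_def dir_deriv_scaleR[OF assms(2)] flip: vf_apply_eq_dir_deriv)
qed

text \<open>No integral curve through \<open>p\<close> is given in advance: by invariance of dimension \<open>\<pi>\<close> is not
  injective near \<open>p\<close>, and the definition of the solution space turns a pair of points
  in one fibre into an integral curve.\<close>

lemma X_\<pi>:
  assumes "p \<in> U"
  shows "X \<pi> p = 0"
proof (rule ccontr)
  assume nz: "X \<pi> p \<noteq> 0"
  have cont: "continuous_on U (X \<pi>)"
    by (intro smooth_on_continuous smooth_on_X smooth_\<pi>)
  define B where "B = U \<inter> X \<pi> -` (- {0})"
  have "open B"
    unfolding B_def using cont open_U by (intro continuous_open_preimage) auto
  moreover have "p \<in> B" using nz assms by (simp add: B_def)
  moreover have "continuous_on B \<pi>"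
    using continuous_on_subset[OF smooth_on_continuous[OF smooth_\<pi>]] by (auto simp: B_def)
  ultimately have "\<not> inj_on \<pi> B"
    using invariance_of_dimension[of B \<pi>] by auto
  then obtain q1 q2 where q: "q1 \<in> B" "q2 \<in> B" "q1 \<noteq> q2" "\<pi> q1 = \<pi> q2"
    unfolding inj_on_def by blast
  then have "same_integral_curve U (X_field F) q1 q2"
    using fibre_iff by (simp add: B_def)
  then obtain c a b where c: "a \<le> b" "{c a, c b} = {q1, q2}"
    "\<And>s. s \<in> {a..b} \<Longrightarrow> c s \<in> U"
    "\<And>s. s \<in> {a..b} \<Longrightarrow> (c has_vector_derivative X_field F (c s)) (at s within {a..b})"
    unfolding same_integral_curve_def by auto
  have "a \<noteq> b" using c(2) q(3) by auto
  then have ab: "a < b" using c(1) by simp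
  \<comment> \<open>Every initial piece of the curve again witnesses
    \<open>same_integral_curve\<close>, so \<open>\<pi>\<close> is constant on the whole arc and
    does not merely agree at its ends.\<close>
  have "\<pi> (c s) = \<pi> (c a)" if s: "s \<in> {a..b}" for s
  proof -
    have "same_integral_curve U (X_field F) (c a) (c s)"
      unfolding same_integral_curve_def
    proof (intro exI conjI ballI)
      show "a \<le> s" using s by simp
      show "{c a, c s} = {c a, c s}" ..
      fix r assume "r \<in> {a..s}"
      then have r: "r \<in> {a..b}" using s by simp
      then show "c r \<in> U" by (rule c(3))
      show "(c has_vector_derivative X_field F (c r)) (at r within {a..s})"
        using s by (intro has_vector_derivative_within_subset[OF c(4)[OF r]]) auto
    qed
    then show ?thesis
      using fibre_iff[of "c a" "c s"] c(3)[OF s] c(3)[of a] ab by auto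
  qed
  \<comment> \<open>The one-sided derivative at \<open>a\<close> is now computed in two ways. The
    point \<open>c a\<close> is one of \<open>q1\<close>, \<open>q2\<close>, hence lies in
    \<open>B\<close>, where \<open>X \<pi>\<close> does not vanish.\<close>
  then have "((\<lambda>s. \<pi> (c s)) has_vector_derivative 0) (at a within {a..b})"
    by (rule has_vector_derivative_transform[rotated, OF _ has_vector_derivative_const]) (use c(1) in simp_all)
  moreover have "((\<lambda>s. \<pi> (c s)) has_vector_derivative X \<pi> (c a)) (at a within {a..b})"
    using ab c(3)[of a] by (intro has_vector_derivative_along_integral_curve c(4) smooth_diff[OF smooth_\<pi>]) auto
  ultimately have "X \<pi> (c a) = 0"
    using vector_derivative_unique_within_closed_interval[of a b a "\<lambda>s. \<pi> (c s)"] ab by auto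
  moreover have "c a \<in> B" using c(2) q(1,2) by auto
  ultimately show False by (simp add: B_def)
qed

lemma constant_on_fibres:
  assumes "smooth_on U H" "\<And>p. p \<in> U \<Longrightarrow> X H p = 0" "p \<in> U" "q \<in> U" "\<pi> p = \<pi> q"
  shows "H p = H q"
proof -
  have "same_integral_curve U (X_field F) p q"
    using fibre_iff assms by blast
  then obtain c a b where c: "a \<le> b" "{c a, c b} = {p, q}"
    "\<And>s. s \<in> {a..b} \<Longrightarrow> c s \<in> U"
    "\<And>s. s \<in> {a..b} \<Longrightarrow> (c has_vector_derivative X_field F (c s)) (at s within {a..b})"
    unfolding same_integral_curve_def by auto
  have "((\<lambda>s. H (c s)) has_vector_derivative 0) (at s within {a..b})" if s: "s \<in> {a..b}" for s
    using has_vector_derivative_along_integral_curve[OF c(4)[OF s] smooth_diff[OF assms(1) c(3)[OF s]]]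
    by (simp add: assms(2) c(3)[OF s])
  then obtain k where "\<And>s. s \<in> {a..b} \<Longrightarrow> H (c s) = k"
    using has_vector_derivative_zero_constant[of "{a..b}" "\<lambda>s. H (c s)"] by auto
  then have "H (c a) = H (c b)" using c(1) by simp
  then show ?thesis using c(2) by (auto simp: doubleton_eq_iff)
qed

abbreviation "\<pi>_0 \<equiv> dir_deriv e_0 \<pi>"
abbreviation "\<pi>_1 \<equiv> dir_deriv e_1 \<pi>"
abbreviation "\<delta> p \<equiv> det2 (\<pi>_0 p) (\<pi>_1 p)"

text \<open>\<open>X_\<pi>\<close> expresses the derivative of \<open>\<pi>\<close> along
  \<open>e_t\<close> by the other two, so \<open>\<pi>_0\<close> and \<open>\<pi>_1\<close> alone
  span the image of the differential.\<close>

lemma dir_deriv_\<pi>: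
  assumes "p \<in> U"
  shows "dir_deriv (t, a, b) \<pi> p = (a - t * jet_x1 p) *\<^sub>R \<pi>_0 p + (b - t * F p) *\<^sub>R \<pi>_1 p"
proof -
  note d = smooth_diff[OF smooth_\<pi> assms]
  have "(t, a, b) = t *\<^sub>R e_t + a *\<^sub>R e_0 + b *\<^sub>R e_1"
    by (simp add: e_t_def e_0_def e_1_def)
  then have "dir_deriv (t, a, b) \<pi> p = t *\<^sub>R dir_deriv e_t \<pi> p + a *\<^sub>R \<pi>_0 p + b *\<^sub>R \<pi>_1 p"
    by (simp only: dir_deriv_add[OF d] dir_deriv_scaleR[OF d])
  moreover have "dir_deriv e_t \<pi> p = - jet_x1 p *\<^sub>R \<pi>_0 p - F p *\<^sub>R \<pi>_1 p"
    using X_eq[OF d] X_\<pi>[OF assms] by (simp add: add_eq_0_iff2 add.assoc)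
  ultimately show ?thesis by (simp add: algebra_simps)
qed

text \<open>By surjectivity every plane vector is a combination of \<open>\<pi>_0 p\<close> and
  \<open>\<pi>_1 p\<close>. If their determinant were zero, every determinant with one of them would
  vanish, and both vectors would be zero.\<close>

lemma \<delta>_nonzero:
  assumes p: "p \<in> U"
  shows "\<delta> p \<noteq> 0"
proof
  assume zero: "\<delta> p = 0"
  have ex: "\<exists>a b. w = a *\<^sub>R \<pi>_0 p + b *\<^sub>R \<pi>_1 p" for w
  proof -
    obtain v where "w = dir_deriv v \<pi> p"
      using surj_\<pi>[OF p] unfolding vf_apply_def by (meson surjD)
    then show ?thesis
      using dir_deriv_\<pi>[OF p] by (metis prod.collapse)
  qed
  have "det2 w (\<pi>_1 p) = 0" "det2 (\<pi>_0 p) w = 0" for w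
    using ex[of w] by (auto simp: det2_simps zero)
  from this[of "(1, 0)"] this[of "(0, 1)"] have "\<pi>_0 p = 0" "\<pi>_1 p = 0"
    by (auto simp: det2_def prod_eq_iff)
  then have "(1 :: real, 0 :: real) = 0"
    using ex[of "(1, 0)"] by simp
  then show False by (simp add: zero_prod_def)
qed

lemma frame_representation:
  assumes "p \<in> U"
  shows "w = (det2 w (\<pi>_1 p) / \<delta> p) *\<^sub>R \<pi>_0 p + (det2 (\<pi>_0 p) w / \<delta> p) *\<^sub>R \<pi>_1 p"
proof -
  have "w = (1 / \<delta> p) *\<^sub>R (\<delta> p *\<^sub>R w)" using \<delta>_nonzero[OF assms] by simp
  also have "\<delta> p *\<^sub>R w = det2 w (\<pi>_1 p) *\<^sub>R \<pi>_0 p + det2 (\<pi>_0 p) w *\<^sub>R \<pi>_1 p"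
    by (rule cramer)
  finally show ?thesis by (simp add: scaleR_add_right)
qed

text \<open>The identity \<open>X_\<pi>\<close> holds on all of \<open>U\<close>, so it may be
  differentiated along \<open>e_1\<close> and the derivative commuted past \<open>X\<close>.\<close>

lemma X_\<pi>_1:
  assumes "p \<in> U"
  shows "X \<pi>_1 p = - \<pi>_0 p - F_1 p *\<^sub>R \<pi>_1 p"
proof -
  have "dir_deriv e_1 (X \<pi>) p = dir_deriv e_1 (\<lambda>_. 0) p"
    by (rule vf_apply_cong_U[OF assms]) (rule X_\<pi>)
  then show ?thesis
    using dir_deriv_X[OF smooth_\<pi> assms, of e_1] by (simp add: add.assoc add_eq_0_iff2)
qed

lemma X_\<pi>_0:
  assumes "p \<in> U"
  shows "X \<pi>_0 p = - F_0 p *\<^sub>R \<pi>_1 p"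
proof -
  have "dir_deriv e_0 (X \<pi>) p = dir_deriv e_0 (\<lambda>_. 0) p"
    by (rule vf_apply_cong_U[OF assms]) (rule X_\<pi>)
  then show ?thesis
    using dir_deriv_X[OF smooth_\<pi> assms, of e_0] by (simp add: add_eq_0_iff2)
qed

text \<open>Restricted to a slice \<open>t = const\<close> the projection is a local diffeomorphism.\<close>

lemma differentiable_descends:
  assumes "p \<in> U" "H differentiable (at p)" "\<And>q. q \<in> U \<Longrightarrow> h (\<pi> q) = H q"
  shows "h differentiable (at (\<pi> p))"
proof -
  obtain t y where p: "p = (t, y)" by (metis prod.exhaust)
  define W where "W = {z. (t, z) \<in> U}"
  define f where "f z = \<pi> (t, z)" for z
  define f' where "f' z v = dir_deriv (0, v) \<pi> (t, z)" for z v
  define g' where "g' w = (det2 w (\<pi>_1 p) / \<delta> p, det2 (\<pi>_0 p) w / \<delta> p)" for w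
  have "open W"
  proof -
    have "open ((\<lambda>z. (t, z)) -` U)"
      by (intro open_vimage open_U continuous_intros)
    then show ?thesis by (simp add: W_def vimage_def)
  qed
  have "y \<in> W" using assms(1) by (simp add: W_def p)
  have f'_eq: "f' z v = fst v *\<^sub>R \<pi>_0 (t, z) + snd v *\<^sub>R \<pi>_1 (t, z)" if "z \<in> W" for z v
    using dir_deriv_\<pi>[of "(t, z)" 0 "fst v" "snd v"] that by (simp add: f'_def W_def)
  have derf: "(f has_derivative f' z) (at z)" if "z \<in> W" for z
  proof -
    have "((\<lambda>z. (t, z)) has_derivative (\<lambda>v. (0, v))) (at z)"
      by (auto intro!: derivative_eq_intros)
    from has_derivative_compose[OF this has_derivative_vf_apply[OF smooth_diff[OF smooth_\<pi>]]] that
    show ?thesis by (simp add: f_def[abs_def] f'_def[abs_def] W_def)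
  qed
  have contf: "continuous_on W f"
    using derf has_derivative_continuous continuous_at_imp_continuous_on by blast
  have g'_linear: "bounded_linear g'"
    unfolding g'_def[abs_def] linear_conv_bounded_linear[symmetric]
    by (intro linearI) (simp_all add: det2_simps add_divide_distrib)
  have g'f': "g' \<circ> f' y = id"
    using \<delta>_nonzero[OF assms(1)] f'_eq[OF \<open>y \<in> W\<close>]
    by (auto simp: fun_eq_iff g'_def det2_simps p)
  have f'g': "f' y \<circ> g' = id"
  proof
    fix w show "(f' y \<circ> g') w = id w"
      using f'_eq[OF \<open>y \<in> W\<close>, of "g' w"] frame_representation[OF assms(1), of w]
      by (simp add: g'_def p)
  qed
  \<comment> \<open>Local injectivity requires \<open>f'\<close> to be continuous in operator norm.
    The norm of the difference is bounded by the change \<open>\<epsilon>\<close> of the two frame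
    vectors, which are continuous.\<close>
  have onorm_cont: "\<exists>d>0. \<forall>z. dist y z < d \<longrightarrow> onorm (\<lambda>v. f' z v - f' y v) < e" if "e > 0" for e
  proof -
    define \<epsilon> where "\<epsilon> z = norm (\<pi>_0 (t, z) - \<pi>_0 (t, y)) + norm (\<pi>_1 (t, z) - \<pi>_1 (t, y))" for z
    have "continuous_on W \<epsilon>"
      unfolding \<epsilon>_def
      by (intro continuous_intros continuous_on_compose2[OF smooth_on_continuous[OF smooth_on_dir_deriv[OF smooth_\<pi>]]])
        (auto simp: W_def)
    then have "isCont \<epsilon> y"
      using \<open>open W\<close> \<open>y \<in> W\<close> by (simp add: continuous_on_eq_continuous_at)
    then obtain d1 where d1: "d1 > 0" "\<And>z. dist z y < d1 \<Longrightarrow> dist (\<epsilon> z) (\<epsilon> y) < e"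
      using \<open>e > 0\<close> unfolding continuous_at_eps_delta by (auto simp: dist_norm)
    obtain d2 where d2: "d2 > 0" "ball y d2 \<subseteq> W"
      using \<open>open W\<close> \<open>y \<in> W\<close> openE by blast
    show ?thesis
    proof (intro exI conjI allI impI)
      show "0 < min d1 d2" using d1 d2 by simp
      fix z assume z: "dist y z < min d1 d2"
      then have "z \<in> W" using d2 by auto
      have "norm (f' z v - f' y v) \<le> \<epsilon> z * norm v" for v
      proof -
        have "f' z v - f' y v = fst v *\<^sub>R (\<pi>_0 (t, z) - \<pi>_0 (t, y)) + snd v *\<^sub>R (\<pi>_1 (t, z) - \<pi>_1 (t, y))"
          by (simp add: f'_eq \<open>z \<in> W\<close> \<open>y \<in> W\<close> algebra_simps)
        also have "norm \<dots> \<le> \<bar>fst v\<bar> * norm (\<pi>_0 (t, z) - \<pi>_0 (t, y)) + \<bar>snd v\<bar> * norm (\<pi>_1 (t, z) - \<pi>_1 (t, y))"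
          by (rule norm_triangle_le) simp
        also have "\<dots> \<le> norm v * norm (\<pi>_0 (t, z) - \<pi>_0 (t, y)) + norm v * norm (\<pi>_1 (t, z) - \<pi>_1 (t, y))"
          using norm_fst_le[of "fst v" "snd v"] norm_snd_le[of "snd v" "fst v"]
          by (intro add_mono mult_right_mono) auto
        finally show ?thesis by (simp add: \<epsilon>_def algebra_simps)
      qed
      then have "onorm (\<lambda>v. f' z v - f' y v) \<le> \<epsilon> z"
        by (rule onorm_le)
      also have "\<epsilon> z < e"
        using d1(2)[of z] z by (simp add: dist_commute dist_real_def \<epsilon>_def)
      finally show "onorm (\<lambda>v. f' z v - f' y v) < e" .
    qed
  qed
  obtain r where r: "r > 0" "ball y r \<subseteq> W" "inj_on f (ball y r)"
    using has_derivative_locally_injective[OF \<open>y \<in> W\<close> \<open>open W\<close> g'_linear g'f' derf onorm_cont] by blast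
  define g where "g = the_inv_into (ball y r) f"
  have gf: "g (f z) = z" if "z \<in> ball y r" for z
    unfolding g_def using the_inv_into_f_f[OF r(3) that] .
  have contf': "continuous_on (ball y r) f"
    using contf r(2) continuous_on_subset by blast
  have dg: "(g has_derivative g') (at (f y))"
    by (rule has_derivative_inverse_strong[OF open_ball _ contf' gf derf[OF \<open>y \<in> W\<close>] f'g'])
      (use r in simp_all)
  have "open (f ` ball y r)"
    by (rule invariance_of_domain[OF contf' open_ball r(3)])
  moreover have "f y \<in> f ` ball y r" using r by simp
  \<comment> \<open>The map sending \<open>m\<close> to \<open>(t, g m)\<close> is a local section
    of \<open>\<pi>\<close>, and \<open>h\<close> is \<open>H\<close> composed with it. Invariance
    of domain makes the image of the ball a neighbourhood on which this identity can be
    used.\<close>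
  moreover have "(\<lambda>m. H (t, g m)) differentiable (at (f y))"
  proof -
    have "((\<lambda>m. (t, g m)) has_derivative (\<lambda>v. (0, g' v))) (at (f y))"
      using dg by (auto intro!: derivative_eq_intros)
    moreover have "H differentiable (at (t, g (f y)))"
      using assms(2) r gf by (simp add: p)
    ultimately show ?thesis
      using differentiable_chain_at[of "\<lambda>m. (t, g m)" "f y" H]
      by (auto simp: o_def differentiable_def)
  qed
  moreover have "H (t, g m) = h m" if "m \<in> f ` ball y r" for m
    using that r(2) gf assms(3) by (auto simp: f_def W_def)
  ultimately have "h differentiable (at (f y))"
    using differentiable_cong[of "f ` ball y r" "f y" "\<lambda>m. H (t, g m)" h] by blast
  then show ?thesis by (simp add: f_def p)
qed

lemma smooth_on_det2: "smooth_on U f \<Longrightarrow> smooth_on U g \<Longrightarrow> smooth_on U (\<lambda>p. det2 (f p) (g p))"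
  by (rule bounded_bilinear.smooth_on_prod[OF bounded_bilinear_det2 open_U])

lemma smooth_frame_coefficients:
  assumes "smooth_on U w"
  shows "smooth_on U (\<lambda>p. det2 (w p) (\<pi>_1 p) / \<delta> p)" "smooth_on U (\<lambda>p. det2 (\<pi>_0 p) (w p) / \<delta> p)"
  using \<delta>_nonzero by (auto intro!: smooth_on_divide open_U smooth_on_det2 smooth_on_dir_deriv smooth_\<pi> assms)

text \<open>A derivative of \<open>h\<close> in a fixed direction \<open>v\<close> again pulls back
  to a smooth function on \<open>U\<close>, namely the derivative of \<open>H\<close> along the lift
  of \<open>v\<close> with coefficients \<open>a\<close> and \<open>b\<close>. The induction
  therefore runs over all pairs \<open>h\<close>, \<open>H\<close> at once.\<close>

lemma smooth_on_descends:
  assumes "smooth_on U H" "\<And>q. q \<in> U \<Longrightarrow> h (\<pi> q) = H q"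
  shows "smooth_on (\<pi> ` U) h"
proof -
  have "times_differentiable_on n (\<pi> ` U) h" for n
    using assms
  proof (induction n arbitrary: h H)
    case 0
    have "h differentiable (at m)" if "m \<in> \<pi> ` U" for m
      using that differentiable_descends[OF _ smooth_diff[OF 0(1)] 0(2)] by auto
    then show ?case
      unfolding times_differentiable_on.simps(1)
      by (intro continuous_at_imp_continuous_on ballI differentiable_imp_continuous_within)
  next
    case (Suc n)
    have dh: "h differentiable (at m)" if "m \<in> \<pi> ` U" for m
      using that differentiable_descends[OF _ smooth_diff[OF Suc(2)] Suc(3)] by auto
    show ?case
    proof (intro times_differentiable_on_SucI ballI allI dh)
      fix v
      define a where "a p = det2 v (\<pi>_1 p) / \<delta> p" for p
      define b where "b p = det2 (\<pi>_0 p) v / \<delta> p" for p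
      show "times_differentiable_on n (\<pi> ` U) (dir_deriv v h)"
      proof (rule Suc.IH)
        show "smooth_on U (\<lambda>p. a p *\<^sub>R dir_deriv e_0 H p + b p *\<^sub>R dir_deriv e_1 H p)"
          unfolding a_def b_def
          by (intro smooth_on_add smooth_on_scaleR smooth_frame_coefficients smooth_on_dir_deriv
              smooth_on_const Suc(2) open_U)
        fix q assume q: "q \<in> U"
        then have d: "h differentiable (at (\<pi> q))" by (intro dh) simp
        have "dir_deriv w H q = dir_deriv (dir_deriv w \<pi> q) h (\<pi> q)" for w
        proof -
          have "dir_deriv w H q = dir_deriv w (\<lambda>p. h (\<pi> p)) q"
            by (rule vf_apply_cong_U[OF q]) (simp add: Suc(3))
          then show ?thesis
            using vf_apply_compose[OF d smooth_diff[OF smooth_\<pi> q]] by simp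
        qed
        then have "a q *\<^sub>R dir_deriv e_0 H q + b q *\<^sub>R dir_deriv e_1 H q
            = dir_deriv (a q *\<^sub>R \<pi>_0 q + b q *\<^sub>R \<pi>_1 q) h (\<pi> q)"
          by (simp add: dir_deriv_add[OF d] dir_deriv_scaleR[OF d])
        then show "dir_deriv v h (\<pi> q) = a q *\<^sub>R dir_deriv e_0 H q + b q *\<^sub>R dir_deriv e_1 H q"
          using frame_representation[OF q, of v] by (simp add: a_def b_def)
      qed
    qed
  qed
  then show ?thesis unfolding smooth_on_def by blast
qed

section \<open>Coefficients in the moving frame\<close>

definition coeff0 :: "jet \<Rightarrow> real \<times> real \<Rightarrow> real" where "coeff0 p v = det2 v (\<pi>_1 p) / \<delta> p"
definition coeff1 :: "jet \<Rightarrow> real \<times> real \<Rightarrow> real" where "coeff1 p v = det2 (\<pi>_0 p) v / \<delta> p"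

lemma coeff_linear [simp]:
  "coeff0 p (v + w) = coeff0 p v + coeff0 p w" "coeff1 p (v + w) = coeff1 p v + coeff1 p w"
  "coeff0 p (v - w) = coeff0 p v - coeff0 p w" "coeff1 p (v - w) = coeff1 p v - coeff1 p w"
  "coeff0 p (- v) = - coeff0 p v" "coeff1 p (- v) = - coeff1 p v"
  "coeff0 p (c *\<^sub>R v) = c * coeff0 p v" "coeff1 p (c *\<^sub>R v) = c * coeff1 p v"
  "coeff0 p 0 = 0" "coeff1 p 0 = 0"
  by (simp_all add: coeff0_def coeff1_def det2_simps add_divide_distrib diff_divide_distrib det2_def[of 0] det2_def[of _ 0])

lemma coeff_frame [simp]:
  assumes "p \<in> U"
  shows "coeff0 p (\<pi>_0 p) = 1" "coeff1 p (\<pi>_0 p) = 0" "coeff0 p (\<pi>_1 p) = 0" "coeff1 p (\<pi>_1 p) = 1"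
  using \<delta>_nonzero[OF assms] by (simp_all add: coeff0_def coeff1_def)

lemma frame_eq: "p \<in> U \<Longrightarrow> v = coeff0 p v *\<^sub>R \<pi>_0 p + coeff1 p v *\<^sub>R \<pi>_1 p"
  using frame_representation by (simp add: coeff0_def coeff1_def)

lemma smooth_coeff:
  "smooth_on U w \<Longrightarrow> smooth_on U (\<lambda>p. coeff0 p (w p))"
  "smooth_on U w \<Longrightarrow> smooth_on U (\<lambda>p. coeff1 p (w p))"
  unfolding coeff0_def coeff1_def by (rule smooth_frame_coefficients, assumption)+

lemma smooth_frame: "smooth_on U \<pi>_0" "smooth_on U \<pi>_1"
  by (simp_all add: smooth_on_dir_deriv smooth_\<pi>)

lemma X_\<delta>:
  assumes "p \<in> U"
  shows "X \<delta> p = - F_1 p * \<delta> p"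
proof -
  have "X (\<lambda>p. \<delta> p) p = det2 (\<pi>_0 p) (X \<pi>_1 p) + det2 (X \<pi>_0 p) (\<pi>_1 p)"
    by (intro bounded_bilinear.vf_apply_prod[OF bounded_bilinear_det2] smooth_diff smooth_frame assms)
  then show ?thesis
    by (simp add: X_\<pi>_0[OF assms] X_\<pi>_1[OF assms] det2_simps)
qed

lemma differentiable_det2:
  "f differentiable (at p) \<Longrightarrow> g differentiable (at p) \<Longrightarrow> (\<lambda>p. det2 (f p) (g p)) differentiable (at p)"
  by (rule bounded_bilinear.differentiable_prod[OF bounded_bilinear_det2])

lemma differentiable_coeff:
  assumes "p \<in> U" "w differentiable (at p)"
  shows "(\<lambda>p. coeff0 p (w p)) differentiable (at p)" "(\<lambda>p. coeff1 p (w p)) differentiable (at p)"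
  unfolding coeff0_def coeff1_def
  by (intro differentiable_divide differentiable_det2 \<delta>_nonzero assms smooth_diff[OF smooth_frame(1)]
      smooth_diff[OF smooth_frame(2)])+

text \<open>The correction terms are the negated matrix of \<open>X\<close> acting on the frame.
  Multiplication by \<open>\<delta>\<close> turns coefficients into determinants, so the Leibniz
  rule replaces the quotient rule.\<close>

lemma
  assumes p: "p \<in> U" and w: "w differentiable (at p)"
  shows X_coeff0: "X (\<lambda>p. coeff0 p (w p)) p = coeff0 p (X w p) + coeff1 p (w p)"
    and X_coeff1: "X (\<lambda>p. coeff1 p (w p)) p = coeff1 p (X w p) + F_0 p * coeff0 p (w p) + F_1 p * coeff1 p (w p)"
proof -
  note d = smooth_diff[OF smooth_frame(1) p] smooth_diff[OF smooth_frame(2) p]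
  have \<delta>k: "\<delta> q * coeff0 q (w q) = det2 (w q) (\<pi>_1 q)" "\<delta> q * coeff1 q (w q) = det2 (\<pi>_0 q) (w q)"
    if "q \<in> U" for q
    using \<delta>_nonzero[OF that] by (simp_all add: coeff0_def coeff1_def)
  have "X (\<lambda>q. \<delta> q * coeff0 q (w q)) p = X (\<lambda>q. det2 (w q) (\<pi>_1 q)) p"
    by (rule vf_apply_cong_U[OF p \<delta>k(1)])
  also have "\<dots> = det2 (w p) (X \<pi>_1 p) + det2 (X w p) (\<pi>_1 p)"
    by (intro bounded_bilinear.vf_apply_prod[OF bounded_bilinear_det2] w d)
  also have "X (\<lambda>q. \<delta> q * coeff0 q (w q)) p = \<delta> p * X (\<lambda>q. coeff0 q (w q)) p + X \<delta> p * coeff0 p (w p)"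
    by (intro vf_apply_mult differentiable_coeff p w differentiable_det2 d)
  finally have "\<delta> p * X (\<lambda>q. coeff0 q (w q)) p
      = det2 (w p) (X \<pi>_1 p) + det2 (X w p) (\<pi>_1 p) + F_1 p * det2 (w p) (\<pi>_1 p)"
    by (simp add: X_\<delta>[OF p] flip: \<delta>k(1)[OF p])
  also have "\<dots> = \<delta> p * coeff0 p (X w p) + \<delta> p * coeff1 p (w p)"
    using \<delta>_nonzero[OF p] by (simp add: X_\<pi>_1[OF p] det2_simps coeff0_def coeff1_def) (simp add: det2_def)
  finally have "\<delta> p * X (\<lambda>q. coeff0 q (w q)) p = \<delta> p * (coeff0 p (X w p) + coeff1 p (w p))"
    by (simp add: distrib_left)
  then show "X (\<lambda>p. coeff0 p (w p)) p = coeff0 p (X w p) + coeff1 p (w p)"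
    using \<delta>_nonzero[OF p] by simp
  have "X (\<lambda>q. \<delta> q * coeff1 q (w q)) p = X (\<lambda>q. det2 (\<pi>_0 q) (w q)) p"
    by (rule vf_apply_cong_U[OF p \<delta>k(2)])
  also have "\<dots> = det2 (\<pi>_0 p) (X w p) + det2 (X \<pi>_0 p) (w p)"
    by (intro bounded_bilinear.vf_apply_prod[OF bounded_bilinear_det2] w d)
  also have "X (\<lambda>q. \<delta> q * coeff1 q (w q)) p = \<delta> p * X (\<lambda>q. coeff1 q (w q)) p + X \<delta> p * coeff1 p (w p)"
    by (intro vf_apply_mult differentiable_coeff p w differentiable_det2 d)
  finally have "\<delta> p * X (\<lambda>q. coeff1 q (w q)) p
      = det2 (\<pi>_0 p) (X w p) + det2 (X \<pi>_0 p) (w p) + F_1 p * det2 (\<pi>_0 p) (w p)"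
    by (simp add: X_\<delta>[OF p] flip: \<delta>k(2)[OF p])
  also have "\<dots> = \<delta> p * coeff1 p (X w p) + F_0 p * (\<delta> p * coeff0 p (w p)) + F_1 p * (\<delta> p * coeff1 p (w p))"
    using \<delta>_nonzero[OF p] by (simp add: X_\<pi>_0[OF p] det2_simps coeff0_def coeff1_def)
      (simp add: det2_def algebra_simps)
  finally have "\<delta> p * X (\<lambda>q. coeff1 q (w q)) p
      = \<delta> p * (coeff1 p (X w p) + F_0 p * coeff0 p (w p) + F_1 p * coeff1 p (w p))"
    by (simp add: algebra_simps)
  then show "X (\<lambda>p. coeff1 p (w p)) p = coeff1 p (X w p) + F_0 p * coeff0 p (w p) + F_1 p * coeff1 p (w p)"
    using \<delta>_nonzero[OF p] by simp
qed

section \<open>The projective system\<close>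

abbreviation "\<pi>_00 \<equiv> dir_deriv e_0 \<pi>_0"
abbreviation "\<pi>_01 \<equiv> dir_deriv e_0 \<pi>_1"
abbreviation "\<pi>_11 \<equiv> dir_deriv e_1 \<pi>_1"

text \<open>The equations for the frame are differentiated once more and commuted past
  \<open>X\<close>. The second derivatives of \<open>F\<close> appear only in front of
  \<open>\<pi>_1\<close>; they are the inhomogeneous terms.\<close>

lemma
  assumes p: "p \<in> U"
  shows X_\<pi>_11: "X \<pi>_11 p = - 2 *\<^sub>R \<pi>_01 p - (2 * F_1 p) *\<^sub>R \<pi>_11 p - F_11 p *\<^sub>R \<pi>_1 p"
    and X_\<pi>_01: "X \<pi>_01 p = - \<pi>_00 p - F_1 p *\<^sub>R \<pi>_01 p - F_0 p *\<^sub>R \<pi>_11 p - F_01 p *\<^sub>R \<pi>_1 p"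
    and X_\<pi>_00: "X \<pi>_00 p = - (2 * F_0 p) *\<^sub>R \<pi>_01 p - F_00 p *\<^sub>R \<pi>_1 p"
proof -
  have comm: "dir_deriv e_1 \<pi>_0 p = \<pi>_01 p"
    by (rule dir_deriv_commute_U[OF smooth_\<pi> p])
  have "dir_deriv v (X \<pi>_1) p = dir_deriv v (\<lambda>q. - \<pi>_0 q - F_1 q *\<^sub>R \<pi>_1 q) p" for v
    by (rule vf_apply_cong_U[OF p X_\<pi>_1])
  then have D1: "dir_deriv v (X \<pi>_1) p = - dir_deriv v \<pi>_0 p
      - (F_1 p *\<^sub>R dir_deriv v \<pi>_1 p + dir_deriv v F_1 p *\<^sub>R \<pi>_1 p)" for v
    using p smooth_frame by (simp add: deriv_rules)
  have "dir_deriv v (X \<pi>_0) p = dir_deriv v (\<lambda>q. - F_0 q *\<^sub>R \<pi>_1 q) p" for v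
    by (rule vf_apply_cong_U[OF p X_\<pi>_0])
  then have D0: "dir_deriv v (X \<pi>_0) p = - (F_0 p *\<^sub>R dir_deriv v \<pi>_1 p + dir_deriv v F_0 p *\<^sub>R \<pi>_1 p)" for v
    using p smooth_frame by (simp add: deriv_rules)
  show "X \<pi>_11 p = - 2 *\<^sub>R \<pi>_01 p - (2 * F_1 p) *\<^sub>R \<pi>_11 p - F_11 p *\<^sub>R \<pi>_1 p"
    using dir_deriv_X[OF smooth_frame(2) p, of e_1] D1[of e_1]
    by (simp add: comm prod_eq_iff algebra_simps)
  show "X \<pi>_01 p = - \<pi>_00 p - F_1 p *\<^sub>R \<pi>_01 p - F_0 p *\<^sub>R \<pi>_11 p - F_01 p *\<^sub>R \<pi>_1 p"
    using dir_deriv_X[OF smooth_frame(2) p, of e_0] D1[of e_0]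
    by (simp add: comm prod_eq_iff algebra_simps)
  show "X \<pi>_00 p = - (2 * F_0 p) *\<^sub>R \<pi>_01 p - F_00 p *\<^sub>R \<pi>_1 p"
    using dir_deriv_X[OF smooth_frame(1) p, of e_0] D0[of e_0]
    by (simp add: comm prod_eq_iff algebra_simps)
qed

text \<open>The vectors are kept abstract because the system is used twice: with a connection added
  to the second derivatives of \<open>\<pi>\<close>, and with these derivatives alone.\<close>

lemma projective_system:
  fixes p11 p01 p00 :: "jet \<Rightarrow> real \<times> real"
  assumes q: "q \<in> U"
    and d: "p11 differentiable (at q)" "p01 differentiable (at q)" "p00 differentiable (at q)"
    and X11: "X p11 q = - 2 *\<^sub>R p01 q - (2 * F_1 q) *\<^sub>R p11 q - F_11 q *\<^sub>R \<pi>_1 q"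
    and X01: "X p01 q = - p00 q - F_1 q *\<^sub>R p01 q - F_0 q *\<^sub>R p11 q - F_01 q *\<^sub>R \<pi>_1 q"
    and X00: "X p00 q = - (2 * F_0 q) *\<^sub>R p01 q - F_00 q *\<^sub>R \<pi>_1 q"
  defines "a1 \<equiv> \<lambda>p. coeff0 p (p11 p)" and "a2 \<equiv> \<lambda>p. coeff1 p (p11 p) - 2 * coeff0 p (p01 p)"
    and "a3 \<equiv> \<lambda>p. coeff0 p (p00 p) - 2 * coeff1 p (p01 p)" and "a4 \<equiv> \<lambda>p. coeff1 p (p00 p)"
  shows "X a1 q = a2 q - 2 * F_1 q * a1 q"
    and "X a2 q = 3 * F_0 q * a1 q - F_1 q * a2 q + 2 * a3 q - F_11 q"
    and "X a3 q = 3 * a4 q + 2 * F_0 q * a2 q + 2 * F_01 q"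
    and "X a4 q = F_0 q * a3 q + F_1 q * a4 q - F_00 q"
  unfolding a1_def a2_def a3_def a4_def
  using q d
  by (simp_all add: vf_apply_diff vf_apply_mult differentiable_coeff X_coeff0 X_coeff1 X11 X01 X00 algebra_simps)

text \<open>The components of \<open>\<Gamma>\<close> in the standard basis depend on the jet only
  through \<open>\<pi>\<close>, so \<open>X\<close> annihilates them and only the two arguments are
  differentiated. The expansion in the basis is forced by the definition of a connection, which
  grants smoothness for fixed arguments only.\<close>

lemma
  assumes tf: "torsion_free_connection (\<pi> ` U) \<Gamma>" and p: "p \<in> U"
    and a: "a differentiable (at p)" and b: "b differentiable (at p)"
  shows differentiable_pullback: "(\<lambda>q. \<Gamma> (\<pi> q) (a q) (b q)) differentiable (at p)"
    and X_pullback: "X (\<lambda>q. \<Gamma> (\<pi> q) (a q) (b q)) p = \<Gamma> (\<pi> p) (X a p) (b p) + \<Gamma> (\<pi> p) (a p) (X b p)"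
proof -
  define g where "g v w q = \<Gamma> (\<pi> q) v w" for v w q
  have dg: "g v w differentiable (at p)" and Xg: "X (g v w) p = 0" for v w
  proof -
    have d: "(\<lambda>m. \<Gamma> m v w) differentiable (at (\<pi> p))"
      using tf p smooth_on_differentiable unfolding torsion_free_connection_def by blast
    note d\<pi> = smooth_diff[OF smooth_\<pi> p]
    show "g v w differentiable (at p)"
      using differentiable_chain_at[OF d\<pi> d] by (simp add: g_def[abs_def] o_def)
    show "X (g v w) p = 0"
      unfolding g_def using vf_apply_compose[OF d d\<pi>, of "X_field F"] X_\<pi>[OF p]
        linear_0[OF linear_vf_apply[OF d]] by simp
  qed
  let ?E1 = "(1, 0) :: real \<times> real" and ?E2 = "(0, 1) :: real \<times> real"
  define f where "f v w q = (fst v * fst w) *\<^sub>R g ?E1 ?E1 q + (fst v * snd w) *\<^sub>R g ?E1 ?E2 q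
      + (snd v * fst w) *\<^sub>R g ?E2 ?E1 q + (snd v * snd w) *\<^sub>R g ?E2 ?E2 q" for v w q
  have expand: "\<Gamma> (\<pi> q) v w = f v w q" if "q \<in> U" for v w q
  proof -
    have bil: "bilinear (\<Gamma> (\<pi> q))"
      using tf that unfolding torsion_free_connection_def by blast
    have "v = fst v *\<^sub>R ?E1 + snd v *\<^sub>R ?E2" "w = fst w *\<^sub>R ?E1 + snd w *\<^sub>R ?E2"
      by (simp_all add: prod_eq_iff)
    then have "\<Gamma> (\<pi> q) v w
        = \<Gamma> (\<pi> q) (fst v *\<^sub>R ?E1 + snd v *\<^sub>R ?E2) (fst w *\<^sub>R ?E1 + snd w *\<^sub>R ?E2)" by metis
    also have "\<dots> = f v w q"
      by (simp only: bilinear_ladd[OF bil] bilinear_radd[OF bil] bilinear_lmul[OF bil] bilinear_rmul[OF bil] f_def g_def)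
        (simp add: algebra_simps)
    finally show ?thesis .
  qed
  have df: "(\<lambda>q. fst (h q)) differentiable (at p)" "(\<lambda>q. snd (h q)) differentiable (at p)"
    and Xf: "X (\<lambda>q. fst (h q)) p = fst (X h p)" "X (\<lambda>q. snd (h q)) p = snd (X h p)"
    if "h differentiable (at p)" for h :: "jet \<Rightarrow> real \<times> real"
    using that bounded_linear.has_derivative[OF bounded_linear_fst has_derivative_vf_apply[OF that]]
      bounded_linear.has_derivative[OF bounded_linear_snd has_derivative_vf_apply[OF that]]
    by (auto simp: vf_apply_bounded_linear bounded_linear_fst bounded_linear_snd differentiable_def)
  have d: "(\<lambda>q. f (a q) (b q) q) differentiable (at p)"
    unfolding f_def
    by (intro differentiable_add differentiable_scaleR_fun differentiable_mult df a b dg)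
  then show "(\<lambda>q. \<Gamma> (\<pi> q) (a q) (b q)) differentiable (at p)"
    using differentiable_cong[OF open_U p, of "\<lambda>q. f (a q) (b q) q" "\<lambda>q. \<Gamma> (\<pi> q) (a q) (b q)"]
    by (simp add: expand)
  have "X (\<lambda>q. \<Gamma> (\<pi> q) (a q) (b q)) p = X (\<lambda>q. f (a q) (b q) q) p"
    by (rule vf_apply_cong_U[OF p expand])
  also have "\<dots> = f (X a p) (b p) p + f (a p) (X b p) p"
    unfolding f_def using df[OF a] df[OF b]
    by (simp add: vf_apply_add vf_apply_scaleR vf_apply_mult differentiable_scaleR_fun dg Xg Xf[OF a] Xf[OF b]
        algebra_simps)
  finally show "X (\<lambda>q. \<Gamma> (\<pi> q) (a q) (b q)) p = \<Gamma> (\<pi> p) (X a p) (b p) + \<Gamma> (\<pi> p) (a p) (X b p)"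
    by (simp add: expand p)
qed

section \<open>Geodesic condition for projected curves\<close>

text \<open>With velocity \<open>l\<close> times \<open>e_1\<close>, the projected curve has
  velocity \<open>l\<close> times \<open>\<pi>_1\<close> and, modulo \<open>\<pi>_1\<close>,
  acceleration \<open>l * l\<close> times \<open>\<pi>_11\<close>. Since \<open>l\<close> is
  nonzero, the parametrisation drops out of the condition.\<close>

lemma unparam_geodesic_projection_iff:
  assumes tf: "torsion_free_connection (\<pi> ` U) \<Gamma>" and c: "integral_curve_D1 U I c"
  shows "unparam_geodesic (\<pi> ` U) \<Gamma> I (\<pi> \<circ> c) \<longleftrightarrow>
    (\<forall>s\<in>I. coeff0 (c s) (\<pi>_11 (c s) + \<Gamma> (\<pi> (c s)) (\<pi>_1 (c s)) (\<pi>_1 (c s))) = 0)"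
proof -
  have reg: "open I" "connected I" "smooth_on I c" "c ` I \<subseteq> U"
    "\<And>s. s \<in> I \<Longrightarrow> vector_derivative c (at s) \<noteq> 0"
    "\<And>s. s \<in> I \<Longrightarrow> vector_derivative c (at s) \<in> span {e_1}"
    using c by (auto simp: integral_curve_D1_def regular_curve_def)
  define l where "l s = jet_x1 (dir_deriv 1 c s)" for s
  have smooth_l: "smooth_on I l"
    unfolding l_def
    by (rule smooth_on_bounded_linear_compose[OF reg(1) bounded_linear_jet_x1 smooth_on_dir_deriv[OF reg(3)]])
  have c': "dir_deriv 1 c s = l s *\<^sub>R e_1" and l: "l s \<noteq> 0" if s: "s \<in> I" for s
  proof -
    have eq: "vector_derivative c (at s) = dir_deriv 1 c s"
      by (rule vector_derivative_eq_dir_deriv[OF smooth_on_differentiable[OF reg(3) s]])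
    then obtain k where k: "dir_deriv 1 c s = k *\<^sub>R e_1"
      using reg(6)[OF s] by (auto simp: span_singleton)
    then have "l s = k" by (simp add: l_def jet_x1_def e_1_def)
    then show "dir_deriv 1 c s = l s *\<^sub>R e_1" "l s \<noteq> 0"
      using k eq reg(5)[OF s] by auto
  qed
  have inU: "c s \<in> U" if "s \<in> I" for s using reg(4) that by blast
  have smooth_comp: "smooth_on I (\<lambda>s. f (c s))" if "smooth_on U f" for f :: "jet \<Rightarrow> real \<times> real"
    by (rule smooth_on_compose[OF reg(1,3) that reg(4)])
  have chain: "dir_deriv 1 (\<lambda>s. f (c s)) s = l s *\<^sub>R dir_deriv e_1 f (c s)"
    if "s \<in> I" "smooth_on U f" for s and f :: "jet \<Rightarrow> real \<times> real"
    using vf_apply_compose[OF smooth_diff[OF that(2) inU[OF that(1)]] smooth_on_differentiable[OF reg(3) that(1)]]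
    by (simp add: c'[OF that(1)] dir_deriv_scaleR smooth_diff[OF that(2) inU[OF that(1)]])
  have velocity: "vector_derivative (\<pi> \<circ> c) (at s) = l s *\<^sub>R \<pi>_1 (c s)" if "s \<in> I" for s
    using vector_derivative_eq_dir_deriv[OF smooth_on_differentiable[OF smooth_comp[OF smooth_\<pi>] that]]
    by (simp add: o_def chain[OF that smooth_\<pi>])
  have smooth_vel: "smooth_on I (\<lambda>s. l s *\<^sub>R \<pi>_1 (c s))"
    by (rule smooth_on_scaleR[OF reg(1) smooth_l smooth_comp[OF smooth_frame(2)]])
  have acceleration: "vector_derivative (\<lambda>r. vector_derivative (\<pi> \<circ> c) (at r)) (at s)
      = dir_deriv 1 l s *\<^sub>R \<pi>_1 (c s) + (l s * l s) *\<^sub>R \<pi>_11 (c s)" if s: "s \<in> I" for s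
  proof -
    have d: "(\<lambda>r. vector_derivative (\<pi> \<circ> c) (at r)) differentiable (at s)"
      using smooth_on_differentiable[OF smooth_vel s]
      by (rule differentiable_cong[OF reg(1) s, rotated]) (simp add: velocity)
    have "vector_derivative (\<lambda>r. vector_derivative (\<pi> \<circ> c) (at r)) (at s)
        = dir_deriv 1 (\<lambda>r. l r *\<^sub>R \<pi>_1 (c r)) s"
      unfolding vector_derivative_eq_dir_deriv[OF d] by (rule vf_apply_cong[OF reg(1) s velocity])
    also have "\<dots> = l s *\<^sub>R dir_deriv 1 (\<lambda>r. \<pi>_1 (c r)) s + dir_deriv 1 l s *\<^sub>R \<pi>_1 (c s)"
      by (rule vf_apply_scaleR[OF smooth_on_differentiable[OF smooth_l s]
            smooth_on_differentiable[OF smooth_comp[OF smooth_frame(2)] s]])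
    finally show ?thesis
      by (simp add: chain[OF s smooth_frame(2)] algebra_simps)
  qed
  have nz: "\<pi>_1 (c s) \<noteq> 0" if "s \<in> I" for s
    using \<delta>_nonzero[OF inU[OF that]] by (auto simp: det2_def)
  have "regular_curve (\<pi> ` U) I (\<pi> \<circ> c)"
    unfolding regular_curve_def
    using reg smooth_comp[OF smooth_\<pi>, folded comp_def] l nz by (auto simp: velocity)
  moreover have "(\<exists>k. vector_derivative (\<lambda>r. vector_derivative (\<pi> \<circ> c) (at r)) (at s)
              + \<Gamma> ((\<pi> \<circ> c) s) (vector_derivative (\<pi> \<circ> c) (at s)) (vector_derivative (\<pi> \<circ> c) (at s))
              = k *\<^sub>R vector_derivative (\<pi> \<circ> c) (at s)) \<longleftrightarrow>
      coeff0 (c s) (\<pi>_11 (c s) + \<Gamma> (\<pi> (c s)) (\<pi>_1 (c s)) (\<pi>_1 (c s))) = 0" if s: "s \<in> I" for s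
  proof -
    let ?a = "\<pi>_11 (c s) + \<Gamma> (\<pi> (c s)) (\<pi>_1 (c s)) (\<pi>_1 (c s))"
    have bil: "bilinear (\<Gamma> (\<pi> (c s)))"
      using tf inU[OF s] unfolding torsion_free_connection_def by blast
    have eq: "vector_derivative (\<lambda>r. vector_derivative (\<pi> \<circ> c) (at r)) (at s)
              + \<Gamma> ((\<pi> \<circ> c) s) (vector_derivative (\<pi> \<circ> c) (at s)) (vector_derivative (\<pi> \<circ> c) (at s))
            = dir_deriv 1 l s *\<^sub>R \<pi>_1 (c s) + (l s * l s) *\<^sub>R ?a"
      by (simp add: acceleration[OF s] velocity[OF s] bilinear_lmul[OF bil] bilinear_rmul[OF bil] algebra_simps)
    show ?thesis
      unfolding eq unfolding velocity[OF s]
    proof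
      assume "\<exists>k. dir_deriv 1 l s *\<^sub>R \<pi>_1 (c s) + (l s * l s) *\<^sub>R ?a = k *\<^sub>R l s *\<^sub>R \<pi>_1 (c s)"
      then obtain k where "dir_deriv 1 l s *\<^sub>R \<pi>_1 (c s) + (l s * l s) *\<^sub>R ?a = k *\<^sub>R l s *\<^sub>R \<pi>_1 (c s)" ..
      then have "coeff0 (c s) (dir_deriv 1 l s *\<^sub>R \<pi>_1 (c s) + (l s * l s) *\<^sub>R ?a)
          = coeff0 (c s) (k *\<^sub>R l s *\<^sub>R \<pi>_1 (c s))" by simp
      then have "(l s * l s) * coeff0 (c s) ?a = 0"
        by (simp only: coeff_linear coeff_frame[OF inU[OF s]] mult_zero_right add_0)
      then show "coeff0 (c s) ?a = 0" using l[OF s] by simp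
    next
      assume zero: "coeff0 (c s) ?a = 0"
      have "?a = coeff0 (c s) ?a *\<^sub>R \<pi>_0 (c s) + coeff1 (c s) ?a *\<^sub>R \<pi>_1 (c s)"
        by (rule frame_eq[OF inU[OF s]])
      then have "?a = coeff1 (c s) ?a *\<^sub>R \<pi>_1 (c s)"
        by (simp only: zero scaleR_zero_left add_0)
      then obtain m where m: "?a = m *\<^sub>R \<pi>_1 (c s)" by blast
      \<comment> \<open>The factor \<open>k\<close> is obtained by comparing the coefficients of
        \<open>\<pi>_1 (c s)\<close> on both sides and dividing by \<open>l s\<close>.\<close>
      show "\<exists>k. dir_deriv 1 l s *\<^sub>R \<pi>_1 (c s) + (l s * l s) *\<^sub>R ?a = k *\<^sub>R l s *\<^sub>R \<pi>_1 (c s)"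
        unfolding m
        by (rule exI[of _ "(dir_deriv 1 l s + l s * l s * m) / l s"])
          (use l[OF s] in \<open>simp add: scaleR_add_left\<close>)
    qed
  qed
  ultimately show ?thesis
    unfolding unparam_geodesic_def by simp
qed

lemma integral_curve_D1_through:
  assumes "p \<in> U"
  obtains I where "(0::real) \<in> I" "integral_curve_D1 U I (\<lambda>s. p + s *\<^sub>R e_1)"
proof -
  obtain r where r: "r > 0" "ball p r \<subseteq> U"
    using open_U assms openE by blast
  have "norm e_1 = 1" by (simp add: e_1_def norm_Pair)
  define I where "I = {-r<..<r}"
  have vd: "vector_derivative (\<lambda>s. p + s *\<^sub>R e_1) (at s) = e_1" for s
    by (rule vector_derivative_at) (auto intro!: derivative_eq_intros)
  have "e_1 \<noteq> 0" by (simp add: e_1_def zero_prod_def)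
  moreover have "p + s *\<^sub>R e_1 \<in> U" if "s \<in> I" for s
    using that r \<open>norm e_1 = 1\<close> by (intro subsetD[OF r(2)]) (auto simp: I_def dist_norm)
  moreover have "smooth_on I (\<lambda>s. p + s *\<^sub>R e_1)"
    by (intro smooth_on_add smooth_on_const smooth_on_bounded_linear bounded_linear_scaleR_left) (simp add: I_def)
  ultimately have "integral_curve_D1 U I (\<lambda>s. p + s *\<^sub>R e_1)"
    unfolding integral_curve_D1_def regular_curve_def by (auto simp: vd I_def span_base)
  moreover have "0 \<in> I" using r by (simp add: I_def)
  ultimately show ?thesis using that by blast
qed

text \<open>All connections of a projective class have the same unparametrised geodesics, so one
  representative suffices. The straight segments along \<open>e_1\<close> reach every point of
  \<open>U\<close>, which converts the condition on curves into one at points.\<close>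

lemma defines_projective_structure_iff:
  "defines_projective_structure U \<pi> \<longleftrightarrow>
    (\<exists>\<Gamma>. torsion_free_connection (\<pi> ` U) \<Gamma> \<and>
      (\<forall>p\<in>U. coeff0 p (\<pi>_11 p + \<Gamma> (\<pi> p) (\<pi>_1 p) (\<pi>_1 p)) = 0))"
proof
  assume "defines_projective_structure U \<pi>"
  then obtain \<Gamma> where tf: "torsion_free_connection (\<pi> ` U) \<Gamma>"
    and geo: "\<And>I c. integral_curve_D1 U I c \<Longrightarrow> unparam_geodesic (\<pi> ` U) \<Gamma> I (\<pi> \<circ> c)"
    unfolding defines_projective_structure_def projective_structure_def
    by (auto simp: projectively_equivalent_def)
  have "coeff0 p (\<pi>_11 p + \<Gamma> (\<pi> p) (\<pi>_1 p) (\<pi>_1 p)) = 0" if p: "p \<in> U" for p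
  proof -
    obtain I where I: "(0::real) \<in> I" "integral_curve_D1 U I (\<lambda>s. p + s *\<^sub>R e_1)"
      using integral_curve_D1_through[OF p] .
    then show ?thesis
      using unparam_geodesic_projection_iff[OF tf I(2)] geo[OF I(2)] by force
  qed
  then show "\<exists>\<Gamma>. torsion_free_connection (\<pi> ` U) \<Gamma> \<and>
      (\<forall>p\<in>U. coeff0 p (\<pi>_11 p + \<Gamma> (\<pi> p) (\<pi>_1 p) (\<pi>_1 p)) = 0)"
    using tf by blast
next
  assume "\<exists>\<Gamma>. torsion_free_connection (\<pi> ` U) \<Gamma> \<and>
      (\<forall>p\<in>U. coeff0 p (\<pi>_11 p + \<Gamma> (\<pi> p) (\<pi>_1 p) (\<pi>_1 p)) = 0)"
  then obtain \<Gamma> where tf: "torsion_free_connection (\<pi> ` U) \<Gamma>"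
    and zero: "\<And>p. p \<in> U \<Longrightarrow> coeff0 p (\<pi>_11 p + \<Gamma> (\<pi> p) (\<pi>_1 p) (\<pi>_1 p)) = 0" by blast
  have geo: "unparam_geodesic (\<pi> ` U) \<Gamma> I (\<pi> \<circ> c)" if c: "integral_curve_D1 U I c" for I c
    unfolding unparam_geodesic_projection_iff[OF tf c]
    using c zero by (auto simp: integral_curve_D1_def regular_curve_def image_subset_iff simp del: coeff_linear)
  let ?P = "{\<Delta>. torsion_free_connection (\<pi> ` U) \<Delta> \<and> projectively_equivalent (\<pi> ` U) \<Gamma> \<Delta>}"
  have "projective_structure (\<pi> ` U) ?P"
    using tf unfolding projective_structure_def by blast
  moreover have "unparam_geodesic (\<pi> ` U) \<Delta> I (\<pi> \<circ> c)" if "integral_curve_D1 U I c" "\<Delta> \<in> ?P" for I c \<Delta>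
    using geo[OF that(1)] that(2) unfolding projectively_equivalent_def by blast
  ultimately show "defines_projective_structure U \<pi>"
    unfolding defines_projective_structure_def by blast
qed

section \<open>From a projective structure to the vanishing of the invariant\<close>

lemma reduced_cartan_eq_0_if_defines_projective_structure:
  assumes "defines_projective_structure U \<pi>" "p \<in> U"
  shows "reduced_cartan p = 0"
proof -
  obtain \<Gamma> where tf: "torsion_free_connection (\<pi> ` U) \<Gamma>"
    and zero: "\<And>p. p \<in> U \<Longrightarrow> coeff0 p (\<pi>_11 p + \<Gamma> (\<pi> p) (\<pi>_1 p) (\<pi>_1 p)) = 0"
    using assms(1) unfolding defines_projective_structure_iff by blast
  define p11 where "p11 p = \<pi>_11 p + \<Gamma> (\<pi> p) (\<pi>_1 p) (\<pi>_1 p)" for p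
  define p01 where "p01 p = \<pi>_01 p + \<Gamma> (\<pi> p) (\<pi>_0 p) (\<pi>_1 p)" for p
  define p00 where "p00 p = \<pi>_00 p + \<Gamma> (\<pi> p) (\<pi>_0 p) (\<pi>_0 p)" for p
  note frame_diff = smooth_diff[OF smooth_frame(1)] smooth_diff[OF smooth_frame(2)]
  note second_diff = smooth_diff[OF smooth_on_dir_deriv[OF smooth_frame(1)]]
    smooth_diff[OF smooth_on_dir_deriv[OF smooth_frame(2)]]
  have d: "p11 differentiable (at q)" "p01 differentiable (at q)" "p00 differentiable (at q)"
    if "q \<in> U" for q
    unfolding p11_def p01_def p00_def
    by (intro differentiable_add differentiable_pullback[OF tf that] frame_diff second_diff that)+
  have X11: "X p11 q = - 2 *\<^sub>R p01 q - (2 * F_1 q) *\<^sub>R p11 q - F_11 q *\<^sub>R \<pi>_1 q"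
    and X01: "X p01 q = - p00 q - F_1 q *\<^sub>R p01 q - F_0 q *\<^sub>R p11 q - F_01 q *\<^sub>R \<pi>_1 q"
    and X00: "X p00 q = - (2 * F_0 q) *\<^sub>R p01 q - F_00 q *\<^sub>R \<pi>_1 q"
    if q: "q \<in> U" for q
  proof -
    have bil: "bilinear (\<Gamma> (\<pi> q))" and sym: "\<Gamma> (\<pi> q) v w = \<Gamma> (\<pi> q) w v" for v w
      using tf q unfolding torsion_free_connection_def by blast+
    have X: "X (\<lambda>q. f q + \<Gamma> (\<pi> q) (a q) (b q)) q = X f q + (\<Gamma> (\<pi> q) (X a q) (b q) + \<Gamma> (\<pi> q) (a q) (X b q))"
      if "smooth_on U a" "smooth_on U b" "smooth_on U f" for f a b
      using differentiable_pullback[OF tf q, of a b] X_pullback[OF tf q, of a b] that q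
      by (simp add: vf_apply_add smooth_diff)
    note smooth2 = smooth_on_dir_deriv[OF smooth_frame(1)] smooth_on_dir_deriv[OF smooth_frame(2)]
    note lin = bilinear_ladd[OF bil] bilinear_radd[OF bil] bilinear_lmul[OF bil] bilinear_rmul[OF bil]
      bilinear_lsub[OF bil] bilinear_rsub[OF bil] bilinear_lneg[OF bil] bilinear_rneg[OF bil]
    show "X p11 q = - 2 *\<^sub>R p01 q - (2 * F_1 q) *\<^sub>R p11 q - F_11 q *\<^sub>R \<pi>_1 q"
      unfolding p11_def[abs_def] p01_def X[OF smooth_frame(2) smooth_frame(2) smooth2(2)]
        X_\<pi>_11[OF q] X_\<pi>_1[OF q]
      by (simp add: lin sym[of "\<pi>_1 q" "\<pi>_0 q"] prod_eq_iff algebra_simps)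
    show "X p01 q = - p00 q - F_1 q *\<^sub>R p01 q - F_0 q *\<^sub>R p11 q - F_01 q *\<^sub>R \<pi>_1 q"
      unfolding p01_def[abs_def] p11_def p00_def X[OF smooth_frame smooth2(2)]
        X_\<pi>_01[OF q] X_\<pi>_1[OF q] X_\<pi>_0[OF q]
      by (simp add: lin prod_eq_iff algebra_simps)
    show "X p00 q = - (2 * F_0 q) *\<^sub>R p01 q - F_00 q *\<^sub>R \<pi>_1 q"
      unfolding p00_def[abs_def] p01_def X[OF smooth_frame(1) smooth_frame(1) smooth2(1)]
        X_\<pi>_00[OF q] X_\<pi>_0[OF q]
      by (simp add: lin sym[of "\<pi>_1 q" "\<pi>_0 q"] prod_eq_iff algebra_simps)
  qed
  define a1 where "a1 = (\<lambda>p. coeff0 p (p11 p))"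
  define a2 where "a2 = (\<lambda>p. coeff1 p (p11 p) - 2 * coeff0 p (p01 p))"
  define a3 where "a3 = (\<lambda>p. coeff0 p (p00 p) - 2 * coeff1 p (p01 p))"
  define a4 where "a4 = (\<lambda>p. coeff1 p (p00 p))"
  have system: "X a1 q = a2 q - 2 * F_1 q * a1 q"
    "X a2 q = 3 * F_0 q * a1 q - F_1 q * a2 q + 2 * a3 q - F_11 q"
    "X a3 q = 3 * a4 q + 2 * F_0 q * a2 q + 2 * F_01 q"
    "X a4 q = F_0 q * a3 q + F_1 q * a4 q - F_00 q" if "q \<in> U" for q
    using projective_system[OF that d[OF that] X11[OF that] X01[OF that] X00[OF that]]
    by (simp_all add: a1_def a2_def a3_def a4_def)
  \<comment> \<open>Each unknown is found on all of the open set \<open>U\<close>, so its value may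
    be differentiated along \<open>X\<close> and substituted into the next equation.\<close>
  have a1: "a1 q = 0" if "q \<in> U" for q
    using zero[OF that] by (simp add: a1_def p11_def)
  have a2: "a2 q = 0" if "q \<in> U" for q
    using vf_apply_cong_U[OF that a1, where Y = "X_field F"] system(1)[OF that] a1[OF that] by simp
  have a3: "a3 q = F_11 q / 2" if "q \<in> U" for q
    using vf_apply_cong_U[OF that a2, where Y = "X_field F"] system(2)[OF that] a1[OF that] a2[OF that] by simp
  have a4: "a4 q = X F_11 q / 6 - 2 / 3 * F_01 q" if q: "q \<in> U" for q
  proof -
    have "X a3 q = X F_11 q / 2"
      using vf_apply_cong_U[OF q a3, where Y = "X_field F"] q by (simp add: deriv_rules)
    then show ?thesis
      using system(3)[OF q] a2[OF q] by simp
  qed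
  have "X a4 p = X (X F_11) p / 6 - 2 / 3 * X F_01 p"
    using vf_apply_cong_U[OF assms(2) a4, where Y = "X_field F"] assms(2) by (simp add: deriv_rules)
  then show ?thesis
    using system(4)[OF assms(2)] a3[OF assms(2)] a4[OF assms(2)] by (simp add: reduced_cartan_def algebra_simps)
qed

section \<open>From the vanishing of the invariant to a connection\<close>

lemma defines_projective_structure_if_reduced_cartan_eq_0:
  assumes "\<And>p. p \<in> U \<Longrightarrow> reduced_cartan p = 0"
  shows "defines_projective_structure U \<pi>"
proof -
  \<comment> \<open>The prescribed values 0, 0, \<open>F_11 / 2\<close> and
    \<open>X F_11 / 6 - 2 / 3 * F_01\<close> are those forced on any solution in the converse
    direction. Subtracting what the second derivatives of \<open>\<pi>\<close> contribute leaves the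
    part a connection must supply.\<close>
  define b1 where "b1 = (\<lambda>p. - coeff0 p (\<pi>_11 p))"
  define b2 where "b2 = (\<lambda>p. - (coeff1 p (\<pi>_11 p) - 2 * coeff0 p (\<pi>_01 p)))"
  define b3 where "b3 = (\<lambda>p. F_11 p / 2 - (coeff0 p (\<pi>_00 p) - 2 * coeff1 p (\<pi>_01 p)))"
  define b4 where "b4 = (\<lambda>p. X F_11 p / 6 - 2 / 3 * F_01 p - coeff1 p (\<pi>_00 p))"
  note smooth2 = smooth_on_dir_deriv[OF smooth_frame(1)] smooth_on_dir_deriv[OF smooth_frame(2)]
  have smooth_b: "smooth_on U b1" "smooth_on U b2" "smooth_on U b3" "smooth_on U b4"
    unfolding b1_def b2_def b3_def b4_def by (simp_all add: smooth_rules smooth_coeff smooth2)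
  \<comment> \<open>Both the prescribed values and those of the second derivatives satisfy the same
    inhomogeneous system. For the prescribed values the fourth equation is the vanishing of
    \<open>reduced_cartan\<close>.\<close>
  have X_b: "X b1 q = b2 q - 2 * F_1 q * b1 q"
    "X b2 q = 3 * F_0 q * b1 q - F_1 q * b2 q + 2 * b3 q"
    "X b3 q = 3 * b4 q + 2 * F_0 q * b2 q"
    "X b4 q = F_0 q * b3 q + F_1 q * b4 q" if q: "q \<in> U" for q
  proof -
    note system = projective_system[OF q smooth_diff[OF smooth2(2) q] smooth_diff[OF smooth2(2) q]
        smooth_diff[OF smooth2(1) q] X_\<pi>_11[OF q] X_\<pi>_01[OF q] X_\<pi>_00[OF q]]
    have sm: "smooth_on U (\<lambda>p. coeff0 p (\<pi>_11 p))" "smooth_on U (\<lambda>p. coeff1 p (\<pi>_11 p) - 2 * coeff0 p (\<pi>_01 p))"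
      "smooth_on U (\<lambda>p. coeff0 p (\<pi>_00 p) - 2 * coeff1 p (\<pi>_01 p))" "smooth_on U (\<lambda>p. coeff1 p (\<pi>_00 p))"
      by (simp_all add: smooth_rules smooth_coeff smooth2)
    note d = sm[THEN smooth_diff, OF q]
    have sF: "smooth_on U (\<lambda>p. F_11 p / 2)" "smooth_on U (\<lambda>p. X F_11 p / 6 - 2 / 3 * F_01 p)"
      by (simp_all add: smooth_rules)
    note dF = sF[THEN smooth_diff, OF q]
    have XF: "X (\<lambda>p. F_11 p / 2) q = X F_11 q / 2"
      "X (\<lambda>p. X F_11 p / 6 - 2 / 3 * F_01 p) q = X (X F_11) q / 6 - 2 / 3 * X F_01 q"
      using q by (simp_all add: deriv_rules)
    show "X b1 q = b2 q - 2 * F_1 q * b1 q"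
      unfolding b1_def b2_def vf_apply_minus[OF d(1)] system(1) by (simp add: algebra_simps)
    show "X b2 q = 3 * F_0 q * b1 q - F_1 q * b2 q + 2 * b3 q"
      unfolding b1_def b2_def b3_def vf_apply_minus[OF d(2)] system(2) by (simp add: algebra_simps)
    show "X b3 q = 3 * b4 q + 2 * F_0 q * b2 q"
      unfolding b2_def b3_def b4_def vf_apply_diff[OF dF(1) d(3)] system(3) XF by (simp add: algebra_simps)
    show "X b4 q = F_0 q * b3 q + F_1 q * b4 q"
      unfolding b3_def b4_def vf_apply_diff[OF dF(2) d(4)] system(4) XF
      using assms[OF q] by (simp add: reduced_cartan_def algebra_simps)
  qed
  \<comment> \<open>the trace-free tensor with projective invariants \<open>b1\<close>, \<open>b2\<close>, \<open>b3\<close>, \<open>b4\<close>\<close>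
  define G11 where "G11 = (\<lambda>p. b1 p *\<^sub>R \<pi>_0 p + (b2 p / 3) *\<^sub>R \<pi>_1 p)"
  define G01 where "G01 = (\<lambda>p. - (b2 p / 3) *\<^sub>R \<pi>_0 p - (b3 p / 3) *\<^sub>R \<pi>_1 p)"
  define G00 where "G00 = (\<lambda>p. (b3 p / 3) *\<^sub>R \<pi>_0 p + b4 p *\<^sub>R \<pi>_1 p)"
  have smooth_G: "smooth_on U G11" "smooth_on U G01" "smooth_on U G00"
    unfolding G11_def G01_def G00_def by (simp_all add: smooth_rules smooth_b smooth_frame)
  \<comment> \<open>These are the equations for the second derivatives of \<open>\<pi>\<close>
    without inhomogeneous terms. The thirds in the components solve \<open>Q - 2 * R = b2\<close>
    with \<open>Q + R = 0\<close>, and \<open>T - 2 * S = b3\<close> with \<open>T + S = 0\<close>,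
    where the second equation of each pair is the trace condition.\<close>
  have X_G: "X G11 q = - 2 *\<^sub>R G01 q - (2 * F_1 q) *\<^sub>R G11 q"
    "X G01 q = - G00 q - F_1 q *\<^sub>R G01 q - F_0 q *\<^sub>R G11 q"
    "X G00 q = - (2 * F_0 q) *\<^sub>R G01 q" if q: "q \<in> U" for q
    using q unfolding G11_def G01_def G00_def
    by (simp_all add: deriv_rules smooth_b smooth_frame X_b X_\<pi>_0 X_\<pi>_1 prod_eq_iff field_simps)
  define \<Gamma>' where "\<Gamma>' q v w = (coeff0 q v * coeff0 q w) *\<^sub>R G00 q + (coeff0 q v * coeff1 q w + coeff1 q v * coeff0 q w) *\<^sub>R G01 q
      + (coeff1 q v * coeff1 q w) *\<^sub>R G11 q" for q v w
  have smooth_\<Gamma>': "smooth_on U (\<lambda>q. \<Gamma>' q v w)" for v w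
    unfolding \<Gamma>'_def by (simp add: smooth_rules smooth_coeff smooth_G)
  have X_coeff_const: "X (\<lambda>q. coeff0 q v) q = coeff1 q v" "X (\<lambda>q. coeff1 q v) q = F_0 q * coeff0 q v + F_1 q * coeff1 q v"
    if "q \<in> U" for q v
    using X_coeff0[OF that, of "\<lambda>_. v"] X_coeff1[OF that, of "\<lambda>_. v"] by simp_all
  \<comment> \<open>For fixed plane vectors \<open>v\<close> and \<open>w\<close>, the derivatives
    of their frame coefficients cancel the right-hand sides of \<open>X_G\<close>.\<close>
  have "X (\<lambda>q. \<Gamma>' q v w) q = 0" if q: "q \<in> U" for q v w
    unfolding \<Gamma>'_def using q
    by (simp add: deriv_rules smooth_coeff smooth_G X_coeff_const X_G prod_eq_iff algebra_simps)
  then have fibre: "\<Gamma>' p v w = \<Gamma>' q v w" if "p \<in> U" "q \<in> U" "\<pi> p = \<pi> q" for p q v w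
    using constant_on_fibres[OF smooth_\<Gamma>' _ that] by blast
  \<comment> \<open>Any point of the fibre may be chosen, by \<open>fibre\<close>.\<close>
  define \<Gamma> where "\<Gamma> m = \<Gamma>' (SOME q. q \<in> U \<and> \<pi> q = m)" for m
  have \<Gamma>: "\<Gamma> (\<pi> q) v w = \<Gamma>' q v w" if "q \<in> U" for q v w
  proof -
    have "(SOME r. r \<in> U \<and> \<pi> r = \<pi> q) \<in> U \<and> \<pi> (SOME r. r \<in> U \<and> \<pi> r = \<pi> q) = \<pi> q"
      by (rule someI[of _ q]) (simp add: that)
    then show ?thesis
      unfolding \<Gamma>_def by (intro fibre that) (rule conjunct1, assumption, rule conjunct2, assumption)
  qed
  have "torsion_free_connection (\<pi> ` U) \<Gamma>"
    unfolding torsion_free_connection_def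
  proof (intro conjI allI ballI)
    show "smooth_on (\<pi> ` U) (\<lambda>m. \<Gamma> m v w)" for v w
      by (rule smooth_on_descends[OF smooth_\<Gamma>' \<Gamma>])
    \<comment> \<open>This covers every \<open>m\<close>, even where the choice is arbitrary:
      \<open>coeff0\<close> and \<open>coeff1\<close> are linear in the vector at every jet.\<close>
    show "bilinear (\<Gamma> m)" for m
      unfolding bilinear_def \<Gamma>_def
      by (intro allI conjI linearI) (simp_all add: \<Gamma>'_def algebra_simps)
    show "\<Gamma> m v w = \<Gamma> m w v" for m v w
      by (simp add: \<Gamma>_def \<Gamma>'_def mult.commute add.commute)
  qed
  moreover have "coeff0 p (\<pi>_11 p + \<Gamma> (\<pi> p) (\<pi>_1 p) (\<pi>_1 p)) = 0" if "p \<in> U" for p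
    using that by (simp add: \<Gamma> \<Gamma>'_def G11_def b1_def)
  ultimately show ?thesis
    unfolding defines_projective_structure_iff by blast
qed

end

theorem theorem6p1:
  fixes F :: "jet \<Rightarrow> real" and U :: "jet set"
  assumes "open U" and "smooth_on U F"
  shows "(\<forall>\<pi> g K. solution_space F U \<pi> \<and> scaling F U g \<and> is_K0 F U g K \<longrightarrow>
            (defines_projective_structure U \<pi> \<longleftrightarrow>
             (\<forall>p\<in>U. obstruction F (V_field g) (V'_field F g) K p = 0))) \<and>
         (\<forall>\<pi>. solution_space F U \<pi> \<longrightarrow>
            (defines_projective_structure U \<pi> \<longleftrightarrow>
             (\<forall>p\<in>U. obstruction F V_explicit (V'_explicit F) (K0 F) p = 0))) \<and>
         (\<forall>p\<in>U. 3 * cartan_invariant F p = obstruction F V_explicit (V'_explicit F) (K0 F) p)"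
proof -
  interpret ode F U
    by unfold_locales fact+
  have explicit: "defines_projective_structure U \<pi> \<longleftrightarrow>
      (\<forall>p\<in>U. obstruction F V_explicit (V'_explicit F) (K0 F) p = 0)"
    if "solution_space F U \<pi>" for \<pi>
  proof -
    interpret solution_projection F U \<pi>
      by unfold_locales fact
    show ?thesis
      using reduced_cartan_eq_0_if_defines_projective_structure defines_projective_structure_if_reduced_cartan_eq_0
      by (auto simp: obstruction_explicit_eq)
  qed
  \<comment> \<open>The two obstructions differ by the factor \<open>g p\<close>, which is nonzero,
    so their zeros agree point by point.\<close>
  have "obstruction F (V_field g) (V'_field F g) K p = 0 \<longleftrightarrow>
      obstruction F V_explicit (V'_explicit F) (K0 F) p = 0"
    if "scaling F U g" "is_K0 F U g K" "p \<in> U" for g K p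
    using obstruction_scaled[OF that] that(1,3) by (simp add: scaling_def)
  then show ?thesis
    using explicit by (simp add: cartan_invariant_eq_reduced_cartan obstruction_explicit_eq)
qed

end
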